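(* For any $s \in [0,1]$, there exists a continuous function $f \in C[0,1]$, $f:[0,1]\to\mathbb{R}$, whose graph $G_f := \{(x,f(x)) : x \in [0,1]\} \subset \mathbb{R}^2$ satisfies $\dim_{\mathrm{F}} G_f = s$, where $\dim_{\mathrm{F}}$ denotes Fourier dimension.
   Context: For a Borel probability measure $\mu$ on $\mathbb{R}^2$, $\widehat{\mu}(\xi) := \int_{\mathbb{R}^2} e^{-2\pi i x\cdot \xi}\, d\mu(x)$, $\xi \in \mathbb{R}^2$. For $K \subset \mathbb{R}^2$, $\mathcal{P}(K)$ is the family of all Borel probability measures supported on $K$ (i.e. $\operatorname{spt}\mu\subset K$), and the Fourier dimension of $K$ is $$\dim_{\mathrm{F}} K := \sup\{0 \leq s \leq 2 : \text{there exist } \mu \in \mathcal{P}(K) \text{ and a constant } C>0 \text{ such that } |\widehat{\mu}(\xi)| \leq C|\xi|^{-s/2} \text{ for all } \xi \in \mathbb{R}^2\setminus\{0\}\}.$$ *)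

theory Defs
  imports "HOL-Probability.Probability"
begin

text \<open>
  The plane is \<^typ>\<open>real \<times> real\<close>, whose library inner product and norm are the Euclidean ones.
\<close>

definition borel_prob_measure :: "(real \<times> real) measure \<Rightarrow> bool" where
  "borel_prob_measure \<mu> \<longleftrightarrow> prob_space \<mu> \<and> sets \<mu> = sets borel"

definition spt :: "(real \<times> real) measure \<Rightarrow> (real \<times> real) set" where
  "spt \<mu> = {x. \<forall>r>0. emeasure \<mu> (ball x r) > 0}"

definition prob_measures_on :: "(real \<times> real) set \<Rightarrow> (real \<times> real) measure set" where
  "prob_measures_on K = {\<mu>. borel_prob_measure \<mu> \<and> spt \<mu> \<subseteq> K}"

definition fourier_transform :: "(real \<times> real) measure \<Rightarrow> real \<times> real \<Rightarrow> complex" where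
  "fourier_transform \<mu> \<xi> = (LINT x|\<mu>. exp (- (2 * complex_of_real pi * \<i> * complex_of_real (x \<bullet> \<xi>))))"

text \<open>
  The supremum is taken in the reals. The set below is bounded above by 2, and for nonempty
  \<open>K\<close> it contains 0 (take a point mass); for \<open>K = {}\<close> it is empty, and
  the value \<^term>\<open>Sup {} :: real\<close> has no mathematical meaning.
\<close>

definition fourier_dim :: "(real \<times> real) set \<Rightarrow> real" where
  "fourier_dim K = Sup {s. 0 \<le> s \<and> s \<le> 2 \<and>
     (\<exists>\<mu>\<in>prob_measures_on K. \<exists>C>0. \<forall>\<xi>. \<xi> \<noteq> 0 \<longrightarrow>
        cmod (fourier_transform \<mu> \<xi>) \<le> C * norm \<xi> powr (- s / 2))}"

definition graph_on :: "real set \<Rightarrow> (real \<Rightarrow> real) \<Rightarrow> (real \<times> real) set" where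
  "graph_on A f = {(x, f x) | x. x \<in> A}"

end

theory Submission
  imports Defs "HOL-Computational_Algebra.Primes" "HOL-Real_Asymp.Real_Asymp"
begin

text \<open>
  For \<open>0 < s\<close>, take independent random digits \<open>\<omega>\<^sub>j\<close>, where \<open>\<omega>\<^sub>j = n / p\<close> with \<open>p\<close> a uniform random prime
  up to \<open>2\<^sup>j\<^sup>+\<^sup>1\<close> and \<open>n < p\<close> uniform, and consider the random point \<open>(X, Y)\<close> with
  \<open>X = \<Sum> \<delta>\<^sub>j \<omega>\<^sub>j\<close>, \<open>Y = \<Sum> 2\<^sup>-\<^sup>j \<omega>\<^sub>j\<close>. The scales \<open>\<delta>\<^sub>j\<close> decay so fast that \<open>X\<close> determines all digits, and
  \<open>X\<close> ranges over a Cantor set with about \<open>\<delta>\<^sub>j powr (-s)\<close> intervals of length \<open>\<delta>\<^sub>j\<close>.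
  The function \<open>f\<close> sends \<open>X\<close> to \<open>Y\<close> and is piecewise affine off the Cantor set.

  Upper bound: a measure whose Fourier transform decays does not charge lines, so on the graph of
  \<open>f\<close> it lives over the Cantor set, and a positive-definite-kernel estimate for its projection to the
  first axis bounds the decay by the number of covering intervals.

  Lower bound: the Fourier transform of the law of \<open>(X, Y)\<close> at \<open>(\<xi>, \<eta>)\<close> is the product of the digit
  transforms at \<open>\<delta>\<^sub>j \<xi> + 2\<^sup>-\<^sup>j \<eta>\<close>. Averaging over primes makes each digit transform as small as the
  inverse square root of the number of digits, up to logarithms, because a nonzero integer has few
  prime divisors; and at most one relevant linear form can be too small for this estimate to apply.
\<close>

section \<open>Counting primes\<close>

text \<open>Nair's route to Chebyshev's lower bound: it forces lcm(1, ..., n+1) to be large.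
  Divisibility spreads from the left edge of each row: the reciprocal of an entry is the reciprocal
  of one in the row above minus that of its left neighbour, so L divided by it is an
  integer.\<close>

lemma Suc_times_binomial_dvd_common_multiple:
  fixes L :: nat
  assumes "\<forall>k\<in>{1..Suc n}. k dvd L" "k \<le> n"
  shows "Suc n * (n choose k) dvd L"
  using assms
proof (induction n arbitrary: k)
  case 0
  then show ?case by simp
next
  case (Suc n)
  note hyp = Suc.IH and common = Suc.prems(1)
  have "j \<le> Suc n \<Longrightarrow> Suc (Suc n) * (Suc n choose j) dvd L" for j
  proof (induction j)
    case 0
    have "Suc (Suc n) dvd L" by (rule bspec[OF common]) simp
    then show ?case by (simp only: binomial_n_0 mult_1_right)
  next
    case (Suc k)
    define a b D where "a = Suc n choose Suc k" and "b = Suc n choose k" and "D = Suc n * (n choose k)"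
    have Da: "Suc k * a = D"
      unfolding a_def D_def using Suc_times_binomial_eq[of n k] by (simp only: mult.commute)
    have Db: "(Suc n - k) * b = D"
      using binomial_absorb_comp[of "Suc n" k] unfolding b_def D_def by simp
    have "D dvd L" unfolding D_def using hyp[of k] common Suc.prems by auto
    then obtain u where u: "L = D * u" by (elim dvdE)
    have "Suc (Suc n) * b dvd L" unfolding b_def using Suc by simp
    then obtain v where v: "L = (Suc (Suc n) * b) * v" by (elim dvdE)
    \<comment> \<open>The reciprocals of \<open>(n + 1) C(n,k)\<close> form Leibniz' harmonic triangle:
      \<open>1/A + 1/B = 1/D\<close> with \<open>A = (n + 2) a\<close>, \<open>B = (n + 2) b\<close>.\<close>
    have "int (Suc k) * (int (Suc (Suc n)) * int a * (int u - int v)) = int (Suc k) * int L"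
    proof -
      have e1: "int (Suc k) * int a = int D" using Da by (metis of_nat_mult)
      have e2: "(int (Suc n) - int k) * int b = int D"
        using Db Suc.prems by (metis Suc_leD of_nat_diff of_nat_mult)
      have e3: "int L = int D * int u" "int L = int (Suc (Suc n)) * int b * int v"
        using u v by (metis of_nat_mult)+
      have "int (Suc k) * (int (Suc (Suc n)) * int a * (int u - int v))
        = int (Suc (Suc n)) * (int D * int u) - int (Suc (Suc n)) * (int D * int v)"
        unfolding e1[symmetric] by (simp only: algebra_simps)
      also have "int D * int u = int L" using e3 by simp
      also have "int (Suc (Suc n)) * (int D * int v) = (int (Suc n) - int k) * int L"
        unfolding e3(2) e2[symmetric] by (simp only: algebra_simps)
      also have "int (Suc (Suc n)) * int L - (int (Suc n) - int k) * int L = int (Suc k) * int L"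
        by (simp add: algebra_simps)
      finally show ?thesis .
    qed
    then have "int L = int (Suc (Suc n) * a) * (int u - int v)"
      by (simp only: mult_left_cancel of_nat_mult of_nat_eq_0_iff)
    then have "int (Suc (Suc n) * a) dvd int L" by (metis dvd_triv_left)
    then show ?case unfolding a_def by (simp only: of_nat_dvd_iff)
  qed
  then show ?case using Suc.prems(2) .
qed

text \<open>Summing the divisibilities over a row of binomials shows lcm(1, ..., n+1) >= 2^n. This
  lcm is a product of prime powers, one for each prime, none of them above n + 1.\<close>

lemma two_power_le_prime_count_power:
  "2 ^ n \<le> Suc n ^ card {p. prime p \<and> p \<le> Suc n}"
proof -
  define N where "N = Suc n"
  define P where "P = {p. prime p \<and> p \<le> N}"
  \<comment> \<open>With these exponents \<open>L\<close> is lcm(1, ..., N), in a form that displays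
    its prime powers.\<close>
  define e where "e p = Max ((\<lambda>k. multiplicity p k) ` {1..N})" for p
  define L where "L = (\<Prod>p\<in>P. p ^ e p)"
  have fin: "finite P" unfolding P_def by auto
  have ne: "N > 0" by (simp add: N_def)
  have pe: "p ^ e p \<le> N" if "p \<in> P" for p
  proof -
    have "e p \<in> (\<lambda>k. multiplicity p k) ` {1..N}"
      unfolding e_def using ne by (intro Max_in) auto
    then obtain k where "k \<in> {1..N}" "e p = multiplicity p k" by auto
    then show ?thesis
      using multiplicity_dvd[of p k] by (auto dest: dvd_imp_le)
  qed
  have Lpos: "L \<noteq> 0" unfolding L_def using fin by (auto simp: P_def)
  have mL: "multiplicity p L = e p" if "p \<in> P" for p
    unfolding L_def using that fin by (subst multiplicity_prod_prime_powers) (auto simp: P_def)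
  have "k dvd L" if k: "k \<in> {1..N}" for k
  proof (rule multiplicity_le_imp_dvd)
    show "k \<noteq> 0" using k by auto
    fix p :: nat assume p: "prime p"
    show "multiplicity p k \<le> multiplicity p L"
    proof (cases "p \<in> P")
      case True
      have "multiplicity p k \<le> e p" unfolding e_def using k by (intro Max_ge) auto
      with mL[OF True] show ?thesis by simp
    next
      case False
      then have "\<not> p dvd k" using p k by (auto simp: P_def dest!: dvd_imp_le)
      then show ?thesis by (simp add: not_dvd_imp_multiplicity_0)
    qed
  qed
  then have dvd: "Suc n * (n choose k) dvd L" if "k \<le> n" for k
    using that by (intro Suc_times_binomial_dvd_common_multiple) (auto simp: N_def)
  have "Suc n * 2 ^ n = (\<Sum>k\<le>n. Suc n * (n choose k))"
    by (simp only: choose_row_sum[symmetric] sum_distrib_left)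
  also have "\<dots> \<le> (\<Sum>k\<le>n. L)"
    using dvd Lpos by (intro sum_mono dvd_imp_le) (auto simp del: mult_Suc)
  also have "\<dots> = Suc n * L" by simp
  finally have "2 ^ n \<le> L" by (simp only: mult_le_cancel1)
  also have "L \<le> (\<Prod>p\<in>P. N)" unfolding L_def using pe by (intro prod_mono) auto
  also have "\<dots> = N ^ card P" by simp
  finally show ?thesis by (simp add: P_def N_def)
qed

text \<open>Chebyshev's bound at powers of two: take n + 1 = 2^k above and compare exponents of
  2.\<close>

lemma prime_count_two_power:
  assumes "k > 0"
  shows "2 ^ (k - 1) \<le> k * card {p. prime p \<and> p \<le> (2::nat) ^ k}"
proof -
  let ?c = "card {p. prime p \<and> p \<le> (2::nat) ^ k}"
  have S: "Suc (2 ^ k - 1) = (2::nat) ^ k" by simp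
  have "(2::nat) ^ (2 ^ k - 1) \<le> 2 ^ (k * ?c)"
    using two_power_le_prime_count_power[of "2 ^ k - 1"] unfolding S by (simp add: power_mult)
  then have "2 ^ k - 1 \<le> k * ?c" by (simp add: power_increasing_iff)
  moreover obtain j where "k = Suc j" using assms gr0_implies_Suc by blast
  moreover have "(1::nat) \<le> 2 ^ (k - 1)" by simp
  ultimately show ?thesis by simp
qed

text \<open>Distinct primes dividing m multiply to a divisor of m, and each is at least 2.\<close>

lemma card_prime_divisors_le:
  fixes m :: nat
  assumes "finite A" "\<And>p. p \<in> A \<Longrightarrow> prime p \<and> p dvd m" "m > 0"
  shows "2 ^ card A \<le> m"
proof -
  have "2 ^ card A = (\<Prod>p\<in>A. 2::nat)" by simp
  also have "\<dots> \<le> \<Prod>A"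
    using assms by (intro prod_mono) (auto dest: prime_ge_2_nat)
  also have "\<Prod>A \<le> m"
  proof (rule dvd_imp_le)
    show "\<Prod>A dvd m" using assms(1,2)
    proof (induction A)
      case (insert p A)
      then have "coprime p (\<Prod>A)" by (intro prod_coprime_right) (auto intro: primes_coprime)
      with insert show ?case by (auto intro: divides_mult)
    qed simp
  qed fact
  finally show ?thesis .
qed

section \<open>Exponential sums over fractions with prime denominator\<close>

lemma harm_le_ln_add_1:
  assumes "n > 0"
  shows "harm n \<le> ln (real n) + 1"
proof -
  obtain m where m: "n = Suc m" using assms gr0_implies_Suc by blast
  show ?thesis unfolding m
  proof (induction m)
    case 0
    then show ?case by (simp add: harm_def)
  next
    case (Suc m)
    have "ln (real (Suc m) / real (Suc (Suc m))) \<le> real (Suc m) / real (Suc (Suc m)) - 1"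
      by (rule ln_le_minus_one) auto
    also have "\<dots> = - inverse (real (Suc (Suc m)))" by (simp add: field_simps)
    finally have "inverse (real (Suc (Suc m))) \<le> ln (real (Suc (Suc m))) - ln (real (Suc m))"
      by (subst (asm) ln_div) auto
    then show ?case using Suc by (subst harm_Suc) linarith
  qed
qed

text \<open>From sin y >= y - y^3/6 with y^2 <= 3; the crude slope 1/2 suffices for bounding a
  geometric sum.\<close>

lemma half_le_sin:
  fixes y :: real
  assumes "0 \<le> y" "y \<le> pi / 2"
  shows "y / 2 \<le> sin y"
proof -
  have "\<bar>sin y - y\<bar> \<le> inverse (fact 3) * \<bar>y\<bar> ^ 3"
    using Maclaurin_sin_bound[of y 3] by (simp add: eval_nat_numeral sin_coeff_def)
  also have "\<dots> = y * y\<^sup>2 / 6"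
    using assms by (simp add: fact_numeral power3_eq_cube power2_eq_square)
  finally have "sin y \<ge> y - y * y\<^sup>2 / 6" by linarith
  moreover have "y\<^sup>2 \<le> 3"
  proof -
    have "y \<le> 1.7" using assms pi_approx by simp
    then have "y\<^sup>2 \<le> 1.7\<^sup>2" using assms by (intro power_mono) auto
    then show ?thesis by (simp add: power2_eq_square)
  qed
  then have "y * y\<^sup>2 \<le> y * 3" using assms by (intro mult_left_mono) auto
  ultimately show ?thesis by simp
qed

lemma norm_sum_cis_le:
  fixes \<theta> :: real
  assumes "\<theta> \<noteq> 0" "\<bar>\<theta>\<bar> \<le> pi"
  shows "norm (\<Sum>n<p. cis (real n * \<theta>)) \<le> 4 / \<bar>\<theta>\<bar>"
proof -
  \<comment> \<open>The denominator of the geometric sum has norm 2 |sin(\<theta>/2)|, hence at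
    least |\<theta>|/2.\<close>
  have "\<bar>\<theta>\<bar> / 2 / 2 \<le> sin (\<bar>\<theta>\<bar> / 2)" using assms by (intro half_le_sin) auto
  also have "\<dots> \<le> \<bar>sin (\<theta> / 2)\<bar>" by (cases "\<theta> \<ge> 0") auto
  finally have *: "\<bar>\<theta>\<bar> / 2 \<le> norm (cis \<theta> - 1)"
    using dist_exp_i_1[of \<theta>] by (simp add: cis_conv_exp)
  then have ne: "cis \<theta> \<noteq> 1" using assms by auto
  have "(\<Sum>n<p. cis (real n * \<theta>)) = (\<Sum>n<p. cis \<theta> ^ n)"
    by (intro sum.cong refl Complex.DeMoivre[symmetric])
  also have "\<dots> = (cis \<theta> ^ p - 1) / (cis \<theta> - 1)" using ne by (rule geometric_sum)
  also have "norm \<dots> \<le> 2 / (\<bar>\<theta>\<bar> / 2)"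
  proof -
    have "norm (cis \<theta> ^ p - 1) \<le> norm (cis \<theta> ^ p) + norm (1::complex)" by (rule norm_triangle_ineq4)
    also have "\<dots> = 2" by (simp add: norm_power)
    finally show ?thesis using * assms unfolding norm_divide by (intro frac_le) auto
  qed
  finally show ?thesis by simp
qed

text \<open>The character of frequency l averaged over the multiples of 1/p in [0,1). For p > 0 and
  integer l it is 1 if p divides l and 0 otherwise; for real l it can be large only near a multiple
  of p.\<close>

definition lattice_mean :: "nat \<Rightarrow> real \<Rightarrow> complex" where
  "lattice_mean p l = (\<Sum>n<p. cis (2 * pi * l * (real n / real p))) / of_nat p"

text \<open>Only the distance from l to its nearest multiple m of p matters, and K is the integer
  part of that distance. The last claim turns this into divisibility of one of two integers that
  depend on l and K alone, so that the primes with a given K can be counted.\<close>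

lemma norm_lattice_mean_le:
  fixes p :: nat and l :: real
  assumes "p > 0"
  defines "m \<equiv> int p * round (l / real p)"
  defines "K \<equiv> nat \<lfloor>\<bar>l - real_of_int m\<bar>\<rfloor>"
  shows "norm (lattice_mean p l) \<le> 2 / real (Suc K)"
    and "K \<le> p" "int p dvd \<lfloor>l\<rfloor> - int K \<or> int p dvd \<lceil>l\<rceil> + int K"
proof -
  define d where "d = l - real_of_int m"
  have p: "real p > 0" using assms by simp
  have "\<bar>l / real p - round (l / real p)\<bar> \<le> 1 / 2"
    using of_int_round_abs_le[of "l / real p"] by (simp add: abs_minus_commute)
  moreover have dp: "d / real p = l / real p - round (l / real p)"
    using p by (simp add: d_def m_def field_simps)
  ultimately have "\<bar>d / real p\<bar> \<le> 1 / 2" by simp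
  then have dle: "\<bar>d\<bar> \<le> real p / 2" using p by (simp add: abs_divide field_simps)
  have K: "K = nat \<lfloor>\<bar>d\<bar>\<rfloor>" by (simp add: K_def d_def)
  have rK: "real K = of_int \<lfloor>\<bar>d\<bar>\<rfloor>" using K by simp
  have K_d: "real K \<le> \<bar>d\<bar>" unfolding rK by linarith
  show "K \<le> p" using K_d dle p by linarith
  \<comment> \<open>Moving l by a multiple of p changes every phase by an integer multiple of 2
    pi.\<close>
  have shift: "cis (2 * pi * l * (real n / real p)) = cis (real n * (2 * pi * d / real p))" for n
  proof -
    have "2 * pi * l * (real n / real p) = real n * (2 * pi * d / real p) + 2 * pi * of_int (int n * round (l / real p))"
      using p by (simp add: d_def m_def field_simps)
    then show ?thesis by (simp only: cis_mult[symmetric] cis_multiple_2pi[OF Ints_of_int] mult_1_right)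
  qed
  have triv: "norm (lattice_mean p l) \<le> 1"
  proof -
    have "norm (\<Sum>n<p. cis (2 * pi * l * (real n / real p))) \<le> (\<Sum>n<p. 1)"
      by (rule sum_norm_le) simp
    then show ?thesis using p by (simp add: lattice_mean_def norm_divide)
  qed
  show "norm (lattice_mean p l) \<le> 2 / real (Suc K)"
  proof (cases "K = 0")
    case True
    then show ?thesis using triv by simp
  next
    case False
    then have d1: "\<bar>d\<bar> \<ge> 1" using K_d by linarith
    define \<theta> where "\<theta> = 2 * pi * d / real p"
    have \<theta>: "\<theta> \<noteq> 0" "\<bar>\<theta>\<bar> \<le> pi"
      using d1 dle p by (auto simp: \<theta>_def abs_mult field_simps)
    have "norm (lattice_mean p l) = norm (\<Sum>n<p. cis (real n * \<theta>)) / real p"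
      unfolding lattice_mean_def shift \<theta>_def norm_divide by simp
    also have "\<dots> \<le> (4 / \<bar>\<theta>\<bar>) / real p"
      using norm_sum_cis_le[OF \<theta>] p by (intro divide_right_mono) auto
    also have "\<dots> = 2 / (pi * \<bar>d\<bar>)" using p by (simp add: \<theta>_def abs_mult)
    also have "\<dots> \<le> 2 / (2 * real K)"
      using K_d False d1 pi_gt3 by (intro divide_left_mono mult_mono) auto
    also have "\<dots> \<le> 2 / real (Suc K)" using False by (simp add: field_simps)
    finally show ?thesis .
  qed
  have pm: "int p dvd m" by (simp add: m_def)
  show "int p dvd \<lfloor>l\<rfloor> - int K \<or> int p dvd \<lceil>l\<rceil> + int K"
  proof (cases "d \<ge> 0")
    case True
    then have "int K = \<lfloor>l\<rfloor> - m" unfolding K by (simp add: d_def le_floor_iff)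
    then show ?thesis using pm by simp
  next
    case False
    then have "int K = \<lfloor>m - l\<rfloor>" unfolding K by (simp add: d_def)
    also have "\<dots> = m - \<lceil>l\<rceil>" by (simp add: ceiling_def) linarith
    finally show ?thesis using pm by simp
  qed
qed

lemma card_prime_divisors_le_log:
  fixes m :: int
  assumes "finite P" "\<And>p. p \<in> P \<Longrightarrow> prime p" "m \<noteq> 0" "\<bar>real_of_int m\<bar> \<le> x"
  shows "real (card {p \<in> P. int p dvd m}) \<le> log 2 x"
proof -
  have "2 ^ card {p \<in> P. int p dvd m} \<le> nat \<bar>m\<bar>"
    using assms by (intro card_prime_divisors_le) (auto simp: dvd_nat_abs_iff)
  then have "real (2 ^ card {p \<in> P. int p dvd m}) \<le> real (nat \<bar>m\<bar>)" by (simp only: of_nat_le_iff)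
  also have "\<dots> \<le> x" using assms by simp
  finally show ?thesis using assms by (subst le_log_iff) (auto simp: powr_realpow)
qed

text \<open>Group the primes by K. Those with K = k divide one of two nonzero integers of size at
  most 2|l|, so there are at most twice log 2 (2|l|) of them, each contributing at most 2/(k+1).
  Summing over k gives the harmonic number.\<close>

lemma sum_norm_lattice_mean_le:
  assumes "finite P" "\<And>p. p \<in> P \<Longrightarrow> prime p \<and> p \<le> N" and l: "\<bar>l\<bar> \<ge> real N + 2"
  shows "(\<Sum>p\<in>P. norm (lattice_mean p l)) \<le> 4 * log 2 (2 * \<bar>l\<bar>) * harm (Suc N)"
proof -
  define K where "K p = nat \<lfloor>\<bar>l - real_of_int (int p * round (l / real p))\<bar>\<rfloor>" for p
  have p0: "p > 0" if "p \<in> P" for p using assms(2)[OF that] prime_gt_0_nat by blast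
  have "(\<Sum>p\<in>P. norm (lattice_mean p l)) \<le> (\<Sum>p\<in>P. 2 / real (Suc (K p)))"
    using p0 norm_lattice_mean_le(1) unfolding K_def by (intro sum_mono) blast
  also have "\<dots> = (\<Sum>k\<in>{..N}. \<Sum>p\<in>{p\<in>P. K p = k}. 2 / real (Suc (K p)))"
  proof (rule sum.group[symmetric])
    show "K ` P \<subseteq> {..N}"
    proof
      fix k assume "k \<in> K ` P"
      then obtain p where p: "p \<in> P" "k = K p" by blast
      have "K p \<le> p" unfolding K_def by (rule norm_lattice_mean_le(2)[OF p0[OF p(1)]])
      with p assms(2)[of p] show "k \<in> {..N}" by simp
    qed
  qed (use assms in auto)
  also have "\<dots> \<le> (\<Sum>k\<in>{..N}. 4 * log 2 (2 * \<bar>l\<bar>) * inverse (real (Suc k)))"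
  proof (rule sum_mono)
    fix k assume k: "k \<in> {..N}"
    define a b where "a = \<lfloor>l\<rfloor> - int k" and "b = \<lceil>l\<rceil> + int k"
    define L where "L = log 2 (2 * \<bar>l\<bar>)"
    have kN: "real k \<le> real N" using k by simp
    have abs_a: "\<bar>real_of_int a\<bar> \<le> 2 * \<bar>l\<bar>" using l kN unfolding a_def by (simp add: abs_le_iff) linarith
    have abs_b: "\<bar>real_of_int b\<bar> \<le> 2 * \<bar>l\<bar>" using l kN unfolding b_def by (simp add: abs_le_iff) linarith
    \<comment> \<open>Here |l| >= N + 2 enters; zero would be divisible by every prime.\<close>
    have "a \<noteq> 0" "b \<noteq> 0" using l kN unfolding a_def b_def by linarith+
    with abs_a abs_b have ca: "card {p \<in> P. int p dvd a} \<le> L" "card {p \<in> P. int p dvd b} \<le> L"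
      unfolding L_def using assms by (auto intro!: card_prime_divisors_le_log)
    have "{p\<in>P. K p = k} \<subseteq> {p \<in> P. int p dvd a} \<union> {p \<in> P. int p dvd b}"
    proof
      fix p assume "p \<in> {p \<in> P. K p = k}"
      then have p: "p \<in> P" "K p = k" by auto
      show "p \<in> {p \<in> P. int p dvd a} \<union> {p \<in> P. int p dvd b}"
        using norm_lattice_mean_le(3)[OF p0[OF p(1)], of l, folded K_def] p unfolding a_def b_def by simp
    qed
    then have "card {p\<in>P. K p = k} \<le> card {p \<in> P. int p dvd a} + card {p \<in> P. int p dvd b}"
      using assms(1) by (intro order_trans[OF card_mono card_Un_le]) auto
    with ca have c: "real (card {p\<in>P. K p = k}) \<le> 2 * L" by linarith
    have "(\<Sum>p\<in>{p\<in>P. K p = k}. 2 / real (Suc (K p))) = real (card {p\<in>P. K p = k}) * (2 / real (Suc k))"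
      by simp
    also have "\<dots> \<le> (2 * L) * (2 / real (Suc k))" using c by (intro mult_right_mono) auto
    finally show "(\<Sum>p\<in>{p\<in>P. K p = k}. 2 / real (Suc (K p))) \<le> 4 * L * inverse (real (Suc k))"
      by (simp add: field_simps)
  qed
  also have "\<dots> = 4 * log 2 (2 * \<bar>l\<bar>) * harm (Suc N)"
    by (simp only: harm_altdef sum_distrib_left lessThan_Suc_atMost)
  finally show ?thesis .
qed

section \<open>Fourier decay and coverings\<close>

text \<open>Let S(x,y) be the sum of the characters n (h x - h y) over n < N. Expanding the square
  shows that the double integral of |S|^2 is the right-hand side. On each \<open>A i\<close> times
  \<open>A i\<close> the phases nearly agree and |S|^2 >= N^2/2; elsewhere |S|^2 >= 0.\<close>

lemma (in prob_space) sum_prob_squares_le: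
  fixes h :: "'a \<Rightarrow> real"
  assumes h[measurable]: "h \<in> borel_measurable M"
    and fin: "finite T" and A[measurable]: "\<And>i. i \<in> T \<Longrightarrow> A i \<in> events"
    and disj: "disjoint_family_on A T" and N: "N > 0"
    and close: "\<And>i x y. i \<in> T \<Longrightarrow> x \<in> A i \<Longrightarrow> y \<in> A i \<Longrightarrow> \<bar>h x - h y\<bar> \<le> 1 / (8 * real N)"
  shows "(real N)\<^sup>2 / 2 * (\<Sum>i\<in>T. (prob (A i))\<^sup>2)
    \<le> (\<Sum>n<N. \<Sum>m<N. (cmod (LINT x|M. cis (2 * pi * (real n - real m) * h x)))\<^sup>2)"
proof -
  define a where "a n m x = cis (2 * pi * (real n - real m) * h x)" for n m x
  define \<phi> where "\<phi> n m = (LINT x|M. a n m x)" for n m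
  define S where "S x y = (\<Sum>n<N. cis (2 * pi * real n * (h x - h y)))" for x y
  have [measurable]: "a n m \<in> borel_measurable M" for n m
    unfolding a_def cis_conv_exp by measurable
  have int_a: "integrable M (a n m)" for n m
    by (rule integrable_const_bound[where B=1]) (auto simp: a_def)
  have expand: "complex_of_real ((cmod (S x y))\<^sup>2) = (\<Sum>n<N. \<Sum>m<N. a n m x * cnj (a n m y))" for x y
  proof -
    have "complex_of_real ((cmod (S x y))\<^sup>2) = S x y * cnj (S x y)" by (simp add: complex_norm_square[symmetric])
    also have "\<dots> = (\<Sum>n<N. \<Sum>m<N. cis (2 * pi * real n * (h x - h y)) * cnj (cis (2 * pi * real m * (h x - h y))))"
      by (simp add: S_def sum_product cnj_sum)
    also have "\<dots> = (\<Sum>n<N. \<Sum>m<N. a n m x * cnj (a n m y))"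
      by (intro sum.cong refl) (simp add: a_def cis_cnj cis_mult algebra_simps)
    finally show ?thesis .
  qed
  define G where "G x = (LINT y|M. (cmod (S x y))\<^sup>2)" for x
  have G_eq: "complex_of_real (G x) = (\<Sum>n<N. \<Sum>m<N. a n m x * cnj (\<phi> n m))" for x
  proof -
    have "complex_of_real (G x) = (LINT y|M. complex_of_real ((cmod (S x y))\<^sup>2))"
      unfolding G_def by (rule integral_complex_of_real[symmetric])
    also have "\<dots> = (\<Sum>n<N. \<Sum>m<N. a n m x * cnj (\<phi> n m))"
      unfolding expand \<phi>_def using int_a
      by (simp add: Bochner_Integration.integral_sum integral_cnj)
    finally show ?thesis .
  qed
  have G_int: "integrable M (\<lambda>x. complex_of_real (G x))"
    unfolding G_eq by (intro Bochner_Integration.integrable_sum integrable_mult_left int_a)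
  have "complex_of_real (LINT x|M. G x) = (LINT x|M. complex_of_real (G x))"
    by (rule integral_complex_of_real[symmetric])
  also have "\<dots> = (\<Sum>n<N. \<Sum>m<N. \<phi> n m * cnj (\<phi> n m))"
    unfolding G_eq using int_a by (simp add: Bochner_Integration.integral_sum \<phi>_def)
  also have "\<dots> = complex_of_real (\<Sum>n<N. \<Sum>m<N. (cmod (\<phi> n m))\<^sup>2)"
    by (simp only: of_real_sum complex_norm_square)
  finally have int_G: "(LINT x|M. G x) = (\<Sum>n<N. \<Sum>m<N. (cmod (\<phi> n m))\<^sup>2)"
    by (simp only: of_real_eq_iff)
  \<comment> \<open>The bound 1/(8N) keeps all angles within pi/4, so each cosine is at least sqrt 2
    / 2.\<close>
  have S_large: "(real N)\<^sup>2 / 2 \<le> (cmod (S x y))\<^sup>2" if "i \<in> T" "x \<in> A i" "y \<in> A i" for i x y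
  proof -
    have u: "\<bar>h x - h y\<bar> \<le> 1 / (8 * real N)" using close that by blast
    have "sqrt 2 / 2 \<le> cos (2 * pi * real n * (h x - h y))" if n: "n < N" for n
    proof -
      have "real n * \<bar>h x - h y\<bar> \<le> real N * (1 / (8 * real N))" using n u by (intro mult_mono) auto
      also have "\<dots> = 1 / 8" using N by simp
      finally have "\<bar>2 * pi * real n * (h x - h y)\<bar> \<le> pi / 4" by (simp add: abs_mult)
      then have "cos (pi / 4) \<le> cos \<bar>2 * pi * real n * (h x - h y)\<bar>"
        by (intro cos_monotone_0_pi_le) auto
      then show ?thesis by (simp add: cos_45)
    qed
    then have "(\<Sum>n<N. sqrt 2 / 2) \<le> Re (S x y)" unfolding S_def Re_sum by (intro sum_mono) auto
    also have "\<dots> \<le> cmod (S x y)" by (rule complex_Re_le_cmod)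
    finally have "(real N * (sqrt 2 / 2))\<^sup>2 \<le> (cmod (S x y))\<^sup>2" by (intro power_mono) auto
    then show ?thesis by (simp add: power_mult_distrib power_divide)
  qed
  have S_int: "integrable M (\<lambda>y. (cmod (S x y))\<^sup>2)" for x
  proof -
    have "integrable M (\<lambda>y. complex_of_real ((cmod (S x y))\<^sup>2))"
      unfolding expand by (intro Bochner_Integration.integrable_sum integrable_mult_right integrable_cnj int_a)
    then show ?thesis by (simp only: complex_of_real_integrable_eq)
  qed
  \<comment> \<open>By disjointness at most one term on the left is nonzero at x.\<close>
  have G_ge: "(\<Sum>i\<in>T. indicator (A i) x * ((real N)\<^sup>2 / 2 * prob (A i))) \<le> G x" for x
  proof (cases "\<exists>i\<in>T. x \<in> A i")
    case True
    then obtain i where i: "i \<in> T" "x \<in> A i" by blast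
    have "(\<Sum>j\<in>T. indicator (A j) x * ((real N)\<^sup>2 / 2 * prob (A j))) = (\<Sum>j\<in>{i}. indicator (A j) x * ((real N)\<^sup>2 / 2 * prob (A j)))"
      using i disj fin by (intro sum.mono_neutral_right) (auto simp: disjoint_family_on_def indicator_def)
    also have "\<dots> = (LINT y|M. (real N)\<^sup>2 / 2 * indicator (A i) y)" using i by simp
    also have "\<dots> \<le> G x" unfolding G_def
    proof (rule integral_mono)
      show "integrable M (\<lambda>y. (real N)\<^sup>2 / 2 * indicator (A i) y)"
        using i by (intro integrable_mult_right integrable_real_indicator) (auto simp: emeasure_eq_measure)
    qed (use i S_int S_large in \<open>auto simp: indicator_def\<close>)
    finally show ?thesis .
  next
    case False
    then have "(\<Sum>i\<in>T. indicator (A i) x * ((real N)\<^sup>2 / 2 * prob (A i))) = 0"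
      by (intro sum.neutral) auto
    also have "0 \<le> G x" unfolding G_def by simp
    finally show ?thesis .
  qed
  have ind: "integrable M (\<lambda>x. indicator (A i) x * ((real N)\<^sup>2 / 2 * prob (A i)))" if "i \<in> T" for i
    using that by (intro integrable_mult_left integrable_real_indicator) (auto simp: emeasure_eq_measure)
  have "(real N)\<^sup>2 / 2 * (\<Sum>i\<in>T. (prob (A i))\<^sup>2)
    = (\<Sum>i\<in>T. LINT x|M. indicator (A i) x * ((real N)\<^sup>2 / 2 * prob (A i)))"
    unfolding sum_distrib_left
    by (intro sum.cong) (auto simp: power2_eq_square sets.Int_space_eq2)
  also have "\<dots> = (LINT x|M. (\<Sum>i\<in>T. indicator (A i) x * ((real N)\<^sup>2 / 2 * prob (A i))))"
    using ind by (intro Bochner_Integration.integral_sum[symmetric])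
  also have "\<dots> \<le> (LINT x|M. G x)"
    using G_ge G_int ind
    by (intro integral_mono Bochner_Integration.integrable_sum) (auto simp: complex_of_real_integrable_eq)
  finally show ?thesis unfolding int_G by (simp add: \<phi>_def a_def)
qed

lemma sum_inverse_dist_le:
  fixes n N :: nat
  assumes "n < N"
  shows "(\<Sum>m\<in>{..<N} - {n}. 1 / \<bar>real n - real m\<bar>) \<le> 2 * harm N"
proof -
  have "(\<Sum>m\<in>{..<N} - {n}. 1 / \<bar>real n - real m\<bar>)
    = (\<Sum>m\<in>{..<n}. 1 / \<bar>real n - real m\<bar>) + (\<Sum>m\<in>{n<..<N}. 1 / \<bar>real n - real m\<bar>)"
    using assms by (subst sum.union_disjoint[symmetric]) (auto intro!: sum.cong)
  also have "(\<Sum>m\<in>{..<n}. 1 / \<bar>real n - real m\<bar>) = harm n"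
    unfolding harm_def by (rule sum.reindex_bij_witness[of _ "\<lambda>k. n - k" "\<lambda>m. n - m"]) (auto simp: of_nat_diff field_simps)
  also have "(\<Sum>m\<in>{n<..<N}. 1 / \<bar>real n - real m\<bar>) = harm (N - Suc n)"
    unfolding harm_def by (rule sum.reindex_bij_witness[of _ "\<lambda>k. n + k" "\<lambda>m. m - n"]) (auto simp: of_nat_diff field_simps)
  finally show ?thesis
    using harm_mono[of n N, where 'a = real] harm_mono[of "N - Suc n" N, where 'a = real] assms by simp
qed

text \<open>In each of the N rows the diagonal contributes 1. Off the diagonal, r^(-s) <= N^(1-s) /
  r for r = |n - m| reduces the row to a harmonic sum, for all s up to 1, at the price of a
  logarithm. Dividing N N^(1-s) by N^2/2 leaves the factor N^(-s).\<close>

lemma (in prob_space) sum_prob_squares_decay: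
  fixes h :: "'a \<Rightarrow> real"
  assumes h[measurable]: "h \<in> borel_measurable M"
    and fin: "finite T" and A[measurable]: "\<And>i. i \<in> T \<Longrightarrow> A i \<in> events"
    and disj: "disjoint_family_on A T" and N: "N > 0"
    and close: "\<And>i x y. i \<in> T \<Longrightarrow> x \<in> A i \<Longrightarrow> y \<in> A i \<Longrightarrow> \<bar>h x - h y\<bar> \<le> 1 / (8 * real N)"
    and s: "0 \<le> s" "s \<le> 1" and D: "0 \<le> D"
    and decay: "\<And>k. k \<noteq> 0 \<Longrightarrow> (cmod (LINT x|M. cis (2 * pi * of_int k * h x)))\<^sup>2 \<le> D * \<bar>of_int k\<bar> powr (- s)"
  shows "(\<Sum>i\<in>T. (prob (A i))\<^sup>2) \<le> (2 + 4 * D) * real N powr (- s) * (1 + ln (real N))"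
proof -
  define f where "f n m = (cmod (LINT x|M. cis (2 * pi * (real n - real m) * h x)))\<^sup>2" for n m
  have N1: "real N \<ge> 1" using N by simp
  have row: "(\<Sum>m<N. f n m) \<le> (1 + 2 * D) * (real N powr (1 - s) * (1 + ln (real N)))" if n: "n < N" for n
  proof -
    have f_le: "f n m \<le> D * real N powr (1 - s) * (1 / \<bar>real n - real m\<bar>)" if m: "m \<in> {..<N} - {n}" for m
    proof -
      define r where "r = \<bar>real n - real m\<bar>"
      have r: "r \<ge> 1" "r \<le> real N" using m n by (auto simp: r_def)
      have "f n m \<le> D * r powr (- s)"
        using decay[of "int n - int m"] m by (simp add: f_def r_def)
      also have "r powr (- s) = r powr (1 - s) * (1 / r)"
        using r by (simp add: powr_diff powr_minus field_simps)
      also have "D * (r powr (1 - s) * (1 / r)) \<le> D * (real N powr (1 - s) * (1 / r))"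
        using r s D by (intro mult_left_mono mult_right_mono powr_mono2) auto
      finally show ?thesis unfolding r_def[symmetric] by (simp only: mult.assoc)
    qed
    have diag: "f n n = 1" by (simp add: f_def prob_space)
    have one: "1 \<le> real N powr (1 - s) * (1 + ln (real N))"
    proof -
      have "1 \<le> real N powr (1 - s)" using N1 s by (intro ge_one_powr_ge_zero) auto
      moreover have "1 \<le> 1 + ln (real N)" using N1 by simp
      ultimately have "1 * 1 \<le> real N powr (1 - s) * (1 + ln (real N))" by (intro mult_mono) auto
      then show ?thesis by simp
    qed
    have "(\<Sum>m<N. f n m) = f n n + (\<Sum>m\<in>{..<N} - {n}. f n m)"
      using n by (intro sum.remove) auto
    also have "\<dots> \<le> 1 + (\<Sum>m\<in>{..<N} - {n}. D * real N powr (1 - s) * (1 / \<bar>real n - real m\<bar>))"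
      using f_le diag by (intro add_mono sum_mono) auto
    also have "\<dots> \<le> 1 + D * real N powr (1 - s) * (2 * harm N)"
      unfolding sum_distrib_left[symmetric] using sum_inverse_dist_le[OF n] D by (intro add_mono mult_left_mono) auto
    also have "\<dots> \<le> 1 + D * real N powr (1 - s) * (2 * (ln (real N) + 1))"
      using harm_le_ln_add_1[OF N] D by (intro add_mono mult_left_mono) auto
    also have "\<dots> = 1 + 2 * D * (real N powr (1 - s) * (1 + ln (real N)))" by simp
    also have "\<dots> \<le> (1 + 2 * D) * (real N powr (1 - s) * (1 + ln (real N)))"
      using one by (simp only: distrib_right mult_1_left add_le_cancel_right)
    finally show ?thesis .
  qed
  have "(real N)\<^sup>2 / 2 * (\<Sum>i\<in>T. (prob (A i))\<^sup>2) \<le> (\<Sum>n<N. \<Sum>m<N. f n m)"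
    unfolding f_def by (rule sum_prob_squares_le[OF h fin A disj N close])
  also have "\<dots> \<le> (\<Sum>n<N. (1 + 2 * D) * (real N powr (1 - s) * (1 + ln (real N))))"
    using row by (intro sum_mono) auto
  also have "\<dots> = (real N)\<^sup>2 / 2 * ((2 + 4 * D) * real N powr (- s) * (1 + ln (real N)))"
    using N1 by (simp add: powr_diff powr_minus power2_eq_square field_simps)
  finally show ?thesis using N1 by (subst (asm) mult_le_cancel_left_pos) auto
qed

text \<open>The masses of the disjoint intervals around S add up to 1, so by Cauchy-Schwarz their
  squares add up to at least 1 / card S. Fast decay makes this sum small, hence many intervals are
  needed.\<close>

lemma (in prob_space) covering_card_ge:
  fixes h :: "'a \<Rightarrow> real"
  assumes h[measurable]: "h \<in> borel_measurable M"
    and fin: "finite S" and r: "r \<ge> 0" and sep: "\<And>c c'. c \<in> S \<Longrightarrow> c' \<in> S \<Longrightarrow> c \<noteq> c' \<Longrightarrow> \<bar>c - c'\<bar> > 2 * r"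
    and cover: "AE x in M. \<exists>c\<in>S. \<bar>h x - c\<bar> \<le> r"
    and N: "N > 0" "2 * r \<le> 1 / (8 * real N)"
    and s: "0 \<le> s" "s \<le> 1" and D: "0 \<le> D"
    and decay: "\<And>k. k \<noteq> 0 \<Longrightarrow> (cmod (LINT x|M. cis (2 * pi * of_int k * h x)))\<^sup>2 \<le> D * \<bar>of_int k\<bar> powr (- s)"
  shows "1 \<le> real (card S) * ((2 + 4 * D) * real N powr (- s) * (1 + ln (real N)))"
proof -
  define A where "A c = {x \<in> space M. \<bar>h x - c\<bar> \<le> r}" for c
  have A[measurable]: "A c \<in> events" for c unfolding A_def by measurable
  have disj: "disjoint_family_on A S"
    unfolding disjoint_family_on_def A_def using sep by fastforce
  have "prob (\<Union>c\<in>S. A c) = 1"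
    using cover by (intro prob_eq_1[THEN iffD2]) (auto simp: A_def fin elim!: eventually_mono)
  also have "prob (\<Union>c\<in>S. A c) = (\<Sum>c\<in>S. prob (A c))"
    using fin disj by (intro finite_measure_finite_Union) auto
  finally have "1 = (\<Sum>c\<in>S. prob (A c))\<^sup>2" by simp
  also have "\<dots> \<le> real (card S) * (\<Sum>c\<in>S. (prob (A c))\<^sup>2)"
    using sum_squared_le_sum_of_squares[of "\<lambda>c. prob (A c)" S] fin by (simp add: mult.commute)
  also have "(\<Sum>c\<in>S. (prob (A c))\<^sup>2) \<le> (2 + 4 * D) * real N powr (- s) * (1 + ln (real N))"
  proof (rule sum_prob_squares_decay[OF h fin A disj N(1) _ s D decay])
    show "\<bar>h x - h y\<bar> \<le> 1 / (8 * real N)" if "x \<in> A c" "y \<in> A c" for c x y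
      using that N(2) unfolding A_def by (auto simp: abs_le_iff)
  qed
  finally show ?thesis by (simp add: mult_left_mono)
qed

section \<open>Supports and null lines of planar measures\<close>

lemma AE_in_of_spt_subset:
  assumes "borel_prob_measure \<mu>" "spt \<mu> \<subseteq> K"
  shows "AE z in \<mu>. z \<in> K"
proof -
  have sets: "sets \<mu> = sets borel" using assms(1) by (simp add: borel_prob_measure_def)
  \<comment> \<open>Each point off the support has a null ball around it; by Lindelof countably many
    of these balls cover, so their union is null.\<close>
  define F where "F = {ball x r | x r. r > 0 \<and> emeasure \<mu> (ball x r) = 0}"
  have "\<And>B. B \<in> F \<Longrightarrow> open B" unfolding F_def by auto
  then obtain F' where F': "F' \<subseteq> F" "countable F'" "\<Union>F' = \<Union>F" using Lindelof by metis
  have "\<Union>F' \<in> null_sets \<mu>"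
  proof -
    have "(\<Union>B\<in>F'. B) \<in> null_sets \<mu>"
      using F' by (intro null_sets_UN') (auto simp: F_def null_sets_def sets)
    then show ?thesis by simp
  qed
  moreover have "{z \<in> space \<mu>. z \<notin> K} \<subseteq> \<Union>F'"
  proof
    fix z assume "z \<in> {z \<in> space \<mu>. z \<notin> K}"
    then have "z \<notin> spt \<mu>" using assms(2) by auto
    then obtain r where "r > 0" "emeasure \<mu> (ball z r) = 0" unfolding spt_def by (auto simp: not_less)
    then have "ball z r \<in> F" "z \<in> ball z r" unfolding F_def by (blast, simp)
    then show "z \<in> \<Union>F'" unfolding F'(3) by blast
  qed
  ultimately show ?thesis by (rule AE_I')
qed

lemma spt_subset_closed:
  assumes "sets \<mu> = sets borel" "closed K" "AE z in \<mu>. z \<in> K"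
  shows "spt \<mu> \<subseteq> K"
proof
  fix x assume x: "x \<in> spt \<mu>"
  show "x \<in> K"
  proof (rule ccontr)
    assume "x \<notin> K"
    then obtain r where r: "r > 0" "ball x r \<subseteq> - K"
      using assms(2) open_contains_ball[of "- K"] by (auto simp: closed_def)
    have "AE z in \<mu>. z \<notin> ball x r" using assms(3) r(2) by (auto elim!: eventually_mono)
    then have "emeasure \<mu> (ball x r) = 0"
      using assms(1) by (subst (asm) AE_iff_measurable[of "ball x r"]) (auto simp: sets_eq_imp_space_eq[OF assms(1)])
    then show False using x r(1) unfolding spt_def by force
  qed
qed

lemma fourier_transform_cis:
  "fourier_transform \<mu> \<xi> = (LINT z|\<mu>. cis (- (2 * pi * (z \<bullet> \<xi>))))"
  unfolding fourier_transform_def cis_conv_exp by (simp add: algebra_simps)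

text \<open>Supplies the hypothesis of \<open>sum_prob_squares_decay\<close> for the projection to
  direction v. The exponent may be lowered to s because |k| >= 1; that estimate takes exponents up
  to 1, while t may be larger.\<close>

lemma decay_along_direction:
  assumes decay: "\<forall>\<xi>. \<xi> \<noteq> 0 \<longrightarrow> cmod (fourier_transform \<mu> \<xi>) \<le> C * norm \<xi> powr (- t / 2)"
    and v: "v \<noteq> 0" and k: "k \<noteq> 0" and s: "s \<le> t"
  shows "(cmod (LINT z|\<mu>. cis (2 * pi * of_int k * (z \<bullet> v))))\<^sup>2
    \<le> (C * norm v powr (- t / 2))\<^sup>2 * \<bar>of_int k\<bar> powr (- s)"
proof -
  have k1: "\<bar>real_of_int k\<bar> \<ge> 1" using k by linarith
  have "(LINT z|\<mu>. cis (2 * pi * of_int k * (z \<bullet> v))) = fourier_transform \<mu> (- of_int k *\<^sub>R v)"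
    unfolding fourier_transform_cis by (simp add: algebra_simps)
  also have "cmod \<dots> \<le> C * norm (- of_int k *\<^sub>R v) powr (- t / 2)"
    using decay k v by (metis neg_equal_0_iff_equal of_int_eq_0_iff scaleR_eq_0_iff)
  also have "\<dots> = C * norm v powr (- t / 2) * \<bar>of_int k\<bar> powr (- t / 2)"
    by (simp add: powr_mult algebra_simps)
  finally have "(cmod (LINT z|\<mu>. cis (2 * pi * of_int k * (z \<bullet> v))))\<^sup>2
      \<le> (C * norm v powr (- t / 2) * \<bar>of_int k\<bar> powr (- t / 2))\<^sup>2"
    by (intro power_mono) auto
  also have "\<dots> = (C * norm v powr (- t / 2))\<^sup>2 * \<bar>of_int k\<bar> powr (- t)"
    by (simp add: power_mult_distrib powr_powr[symmetric] powr_realpow[symmetric] power2_eq_square powr_add[symmetric])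
  also have "\<dots> \<le> (C * norm v powr (- t / 2))\<^sup>2 * \<bar>of_int k\<bar> powr (- s)"
    using k1 s by (intro mult_left_mono powr_mono) auto
  finally show ?thesis .
qed

text \<open>The inner product with v = (-m, 1) is constant on the line, so the whole line serves as
  one single block for every N. Its squared mass is therefore O(N^(-min t 1) log N), and N is
  free.\<close>

lemma AE_not_on_line:
  assumes \<mu>: "borel_prob_measure \<mu>"
    and decay: "\<forall>\<xi>. \<xi> \<noteq> 0 \<longrightarrow> cmod (fourier_transform \<mu> \<xi>) \<le> C * norm \<xi> powr (- t / 2)"
    and t: "t > 0"
  shows "AE z in \<mu>. snd z \<noteq> m * fst z + c"
proof -
  interpret prob_space \<mu> using \<mu> by (simp add: borel_prob_measure_def)
  have sets[measurable_cong]: "sets \<mu> = sets borel" using \<mu> by (simp add: borel_prob_measure_def)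
  define v :: "real \<times> real" where "v = (- m, 1)"
  define A where "A = {z :: real \<times> real. z \<bullet> v = c}"
  define D where "D = (C * norm v powr (- t / 2))\<^sup>2"
  have A: "A \<in> events"
    unfolding A_def sets by (intro borel_closed closed_Collect_eq continuous_intros)
  have "(prob A)\<^sup>2 \<le> (2 + 4 * D) * real N powr (- min t 1) * (1 + ln (real N))" if N: "N > 0" for N
  proof -
    have "(\<Sum>i\<in>{()}. (prob ((\<lambda>_. A) i))\<^sup>2) \<le> (2 + 4 * D) * real N powr (- min t 1) * (1 + ln (real N))"
    proof (rule sum_prob_squares_decay[where h = "\<lambda>z. z \<bullet> v"])
      fix k :: int assume k: "k \<noteq> 0"
      show "(cmod (expectation (\<lambda>x. cis (2 * pi * real_of_int k * (x \<bullet> v)))))\<^sup>2 \<le> D * \<bar>real_of_int k\<bar> powr - min t 1"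
        unfolding D_def using k by (intro decay_along_direction decay) (auto simp: v_def zero_prod_def)
    qed (use A t N in \<open>auto simp: A_def D_def disjoint_family_on_def\<close>)
    then show ?thesis by simp
  qed
  then have "eventually (\<lambda>N. (prob A)\<^sup>2 \<le> (2 + 4 * D) * real N powr (- min t 1) * (1 + ln (real N))) sequentially"
    by (rule eventually_mono[OF eventually_gt_at_top])
  moreover have "(\<lambda>N. (2 + 4 * D) * real N powr (- min t 1) * (1 + ln (real N))) \<longlonglongrightarrow> 0"
  proof -
    define a where "a = min t 1"
    have "a > 0" using t by (simp add: a_def)
    then show ?thesis unfolding a_def[symmetric] by real_asymp
  qed
  ultimately have "(prob A)\<^sup>2 \<le> 0"
    by (intro tendsto_le[OF sequentially_bot _ tendsto_const]) auto
  then have "prob A = 0" by simp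
  then have "A \<in> null_sets \<mu>" using A by (simp add: null_sets_def emeasure_eq_measure)
  then show ?thesis by (rule AE_I') (auto simp: A_def v_def inner_prod_def)
qed

section \<open>The function\<close>

text \<open>A weak form of piecewise affinity. Being covered by countably many nonvertical lines
  passes to sums and multiples without tracking break points, and a measure with decay gives such
  lines mass zero.\<close>

definition graph_in_lines :: "(real \<Rightarrow> real) \<Rightarrow> bool" where
  "graph_in_lines g \<longleftrightarrow> (\<exists>L. countable L \<and> (\<forall>x. \<exists>(m, c)\<in>L. g x = m * x + c))"

lemma graph_in_lines_const: "graph_in_lines (\<lambda>x. a)"
  unfolding graph_in_lines_def by (rule exI[of _ "{(0, a)}"]) auto

lemma graph_in_lines_add:
  assumes "graph_in_lines g" "graph_in_lines h"
  shows "graph_in_lines (\<lambda>x. g x + h x)"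
proof -
  obtain L L' where L: "countable L" "\<And>x. \<exists>(m, c)\<in>L. g x = m * x + c"
    and L': "countable L'" "\<And>x. \<exists>(m, c)\<in>L'. h x = m * x + c"
    using assms unfolding graph_in_lines_def by blast
  have "\<exists>(m, c)\<in>(\<lambda>((m, c), m', c'). (m + m', c + c')) ` (L \<times> L'). g x + h x = m * x + c" for x
  proof -
    obtain m c m' c' where "(m, c) \<in> L" "g x = m * x + c" "(m', c') \<in> L'" "h x = m' * x + c'"
      using L(2)[of x] L'(2)[of x] by auto
    then show ?thesis by (intro bexI[of _ "(m + m', c + c')"]) (force simp: algebra_simps)+
  qed
  then show ?thesis unfolding graph_in_lines_def using L(1) L'(1)
    by (intro exI[of _ "(\<lambda>((m, c), m', c'). (m + m', c + c')) ` (L \<times> L')"]) auto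
qed

lemma graph_in_lines_mult:
  assumes "graph_in_lines g"
  shows "graph_in_lines (\<lambda>x. a * g x)"
proof -
  obtain L where L: "countable L" "\<And>x. \<exists>(m, c)\<in>L. g x = m * x + c"
    using assms unfolding graph_in_lines_def by blast
  have "\<exists>(m, c)\<in>(\<lambda>(m, c). (a * m, a * c)) ` L. a * g x = m * x + c" for x
  proof -
    obtain m c where "(m, c) \<in> L" "g x = m * x + c" using L(2)[of x] by auto
    then show ?thesis by (intro bexI[of _ "(a * m, a * c)"]) (force simp: algebra_simps)+
  qed
  then show ?thesis unfolding graph_in_lines_def using L(1)
    by (intro exI[of _ "(\<lambda>(m, c). (a * m, a * c)) ` L"]) auto
qed

lemma graph_in_lines_sum:
  assumes "finite A" "\<And>i. i \<in> A \<Longrightarrow> graph_in_lines (g i)"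
  shows "graph_in_lines (\<lambda>x. \<Sum>i\<in>A. g i x)"
  using assms by (induction A) (auto intro: graph_in_lines_const graph_in_lines_add)

text \<open>Equals 1 for |u| <= 4/3 and 0 for |u| >= 3/2. The plateau just accommodates the tails of
  X, which are at most 1 + 1/4 + 1/16 + ... = 4/3 times the current scale.\<close>

definition trapezoid :: "real \<Rightarrow> real" where
  "trapezoid u = max 0 (min 1 (9 - 6 * \<bar>u\<bar>))"

lemma graph_in_lines_trapezoid: "graph_in_lines (\<lambda>x. trapezoid ((x - a) / b))"
proof -
  define L where "L = {(0, 0), (0, 1), (6 / b, 9 - 6 * a / b), (- 6 / b, 9 + 6 * a / b)}"
  have "\<exists>(m, c)\<in>L. trapezoid ((x - a) / b) = m * x + c" for x
    unfolding trapezoid_def L_def by (auto simp: max_def min_def abs_if diff_divide_distrib)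
  then show ?thesis unfolding graph_in_lines_def by (intro exI[of _ L]) (auto simp: L_def)
qed

lemma continuous_trapezoid [continuous_intros]:
  "continuous_on A g \<Longrightarrow> continuous_on A (\<lambda>x. trapezoid (g x))"
  unfolding trapezoid_def by (intro continuous_intros)

locale salem_graph =
  fixes s :: real
  assumes s_pos: "0 < s" and s_le: "s \<le> 1"
begin

definition \<sigma> :: real where "\<sigma> = 1 / s"

definition small_primes :: "nat \<Rightarrow> nat set" where
  "small_primes j = {p. prime p \<and> p \<le> 2 ^ Suc j}"

definition digits :: "nat \<Rightarrow> real set" where
  "digits j = {real n / real p | n p. p \<in> small_primes j \<and> n < p}"

text \<open>\<open>ends j\<close> will have at most 2^(j^2+j) points, and this times
  \<open>\<delta> j powr s\<close> is 2^(-2j), which beats polynomial losses in j. The ratio of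
  consecutive scales is at most 4^(-(j+2)), a quarter of the digit gap 4^(-(j+1)).\<close>

definition \<delta> :: "nat \<Rightarrow> real" where
  "\<delta> j = 2 powr (- \<sigma> * (real j ^ 2 + 3 * real j))"

text \<open>
  The Cantor set is the set of sums of all \<open>\<delta> j * d\<^sub>j\<close> with \<open>d\<^sub>j \<in> digits j\<close>; \<open>ends j\<close> holds the partial
  sums of length \<open>j\<close>, and \<open>digit_fun j\<close> reads off \<open>d\<^sub>j\<close> on it.
\<close>

primrec ends :: "nat \<Rightarrow> real set" where
  "ends 0 = {0}"
| "ends (Suc j) = (\<lambda>(c, d). c + \<delta> j * d) ` (ends j \<times> digits j)"

definition digit_fun :: "nat \<Rightarrow> real \<Rightarrow> real" where
  "digit_fun j x = (\<Sum>(c, d)\<in>ends j \<times> digits j. d * trapezoid ((x - (c + \<delta> j * d)) / \<delta> (Suc j)))"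

definition f :: "real \<Rightarrow> real" where
  "f x = (\<Sum>j. (1 / 2) ^ j * digit_fun j x)"

text \<open>The factor 3/2 is the support radius of \<open>trapezoid\<close>, so
  \<open>digit_fun j\<close> vanishes off \<open>nbhd (Suc j)\<close>. It is less than half of 4,
  the separation of \<open>ends j\<close> in units of \<open>\<delta> j\<close>.\<close>

definition nbhd :: "nat \<Rightarrow> real set" where
  "nbhd j = {x. \<exists>c\<in>ends j. \<bar>x - c\<bar> \<le> 3 / 2 * \<delta> j}"

section \<open>Size and separation of the Cantor set\<close>

lemma \<sigma>_ge: "\<sigma> \<ge> 1"
  using s_pos s_le by (simp add: \<sigma>_def)

lemma \<delta>_pos: "\<delta> j > 0"
  by (simp add: \<delta>_def)

lemma \<delta>_0: "\<delta> 0 = 1"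
  by (simp add: \<delta>_def)

lemma \<delta>_Suc: "\<delta> (Suc j) \<le> \<delta> j / 4 ^ (j + 2)"
proof -
  have "\<delta> (Suc j) = \<delta> j * 2 powr (- \<sigma> * (2 * real j + 4))"
    unfolding \<delta>_def by (simp add: powr_add[symmetric] power2_eq_square algebra_simps)
  also have "\<dots> \<le> \<delta> j * 2 powr (- 1 * (2 * real j + 4))"
    using \<sigma>_ge by (intro mult_left_mono powr_mono mult_right_mono) (auto simp: \<delta>_def)
  also have "2 powr (- 1 * (2 * real j + 4)) = 1 / 4 ^ (j + 2)"
  proof -
    have "2 powr (2 * real j + 4) = 2 powr real (2 * (j + 2))" by (simp add: add.commute)
    also have "\<dots> = 4 ^ (j + 2)" by (subst powr_realpow) (simp_all add: power_mult)
    finally show ?thesis by (simp only: mult_minus1 powr_minus_divide)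
  qed
  finally show ?thesis by simp
qed

lemma \<delta>_Suc_le: "\<delta> (Suc j) \<le> \<delta> j / 4"
proof -
  have "\<delta> j / 4 ^ (j + 2) \<le> \<delta> j / 4 ^ 1"
    using \<delta>_pos[of j] by (intro divide_left_mono power_increasing) auto
  then show ?thesis using \<delta>_Suc[of j] by simp
qed

lemma \<delta>_add_le: "\<delta> (j + i) \<le> \<delta> j * (1 / 4) ^ i"
proof (induction i)
  case (Suc i)
  then show ?case using \<delta>_Suc_le[of "j + i"] by simp
qed simp

lemma \<delta>_le_1: "\<delta> j \<le> 1"
  using \<delta>_add_le[of 0 j] \<delta>_0 power_le_one[of "1/4::real" j] by simp

lemma finite_small_primes: "finite (small_primes j)"
  by (simp add: small_primes_def)

lemma two_in_small_primes: "2 \<in> small_primes j"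
  by (simp add: small_primes_def)

lemma small_primes_pos: "p \<in> small_primes j \<Longrightarrow> 0 < p"
  by (auto simp: small_primes_def dest: prime_gt_0_nat)

lemma digits_eq_image: "digits j = (\<lambda>(p, n). real n / real p) ` (SIGMA p:small_primes j. {..<p})"
  unfolding digits_def by force

lemma finite_digits: "finite (digits j)"
  unfolding digits_eq_image using finite_small_primes by auto

lemma card_digits: "card (digits j) \<le> 4 ^ Suc j"
proof -
  have "card (digits j) \<le> card (SIGMA p:small_primes j. {..<p})"
    unfolding digits_eq_image using finite_small_primes by (intro card_image_le) auto
  also have "\<dots> = (\<Sum>p\<in>small_primes j. p)" using finite_small_primes by simp
  also have "\<dots> \<le> (\<Sum>p\<in>small_primes j. 2 ^ Suc j)"
    by (intro sum_mono) (simp add: small_primes_def)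
  also have "\<dots> = card (small_primes j) * 2 ^ Suc j" by simp
  also have "card (small_primes j) \<le> card {1..(2::nat) ^ Suc j}"
    using small_primes_pos by (intro card_mono) (auto simp: small_primes_def Suc_le_eq prime_gt_0_nat)
  finally show ?thesis by (simp add: power_mult_distrib[symmetric])
qed

lemma digits_range:
  assumes "d \<in> digits j"
  shows "0 \<le> d" "d \<le> 1 - 1 / 2 ^ Suc j" "d \<le> 1"
proof -
  obtain n p where d: "d = real n / real p" "n < p" "p \<le> 2 ^ Suc j"
    using assms by (auto simp: digits_def small_primes_def)
  show "0 \<le> d" using d by simp
  have p: "real p \<le> 2 ^ Suc j" using d(3) by (metis of_nat_le_iff of_nat_numeral of_nat_power)
  have "d \<le> (real p - 1) / real p" unfolding d(1) using d(2) by (intro divide_right_mono) auto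
  also have "\<dots> = 1 - 1 / real p" using d(2) by (simp add: field_simps)
  also have "\<dots> \<le> 1 - 1 / 2 ^ Suc j" using p d(2) by (intro diff_left_mono divide_left_mono) auto
  finally show "d \<le> 1 - 1 / 2 ^ Suc j" .
  also have "\<dots> \<le> 1" by simp
  finally show "d \<le> 1" .
qed

text \<open>Two different fractions with denominators p and p' are at least 1/(p p') apart.\<close>

lemma digits_sep:
  assumes "d \<in> digits j" "d' \<in> digits j" "d \<noteq> d'"
  shows "1 / 4 ^ Suc j \<le> \<bar>d - d'\<bar>"
proof -
  obtain n p where d: "d = real n / real p" "n < p" "p \<le> 2 ^ Suc j"
    using assms(1) by (auto simp: digits_def small_primes_def)
  obtain n' p' where d': "d' = real n' / real p'" "n' < p'" "p' \<le> 2 ^ Suc j"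
    using assms(2) by (auto simp: digits_def small_primes_def)
  define k where "k = int n * int p' - int n' * int p"
  have pp: "real p * real p' > 0" using d d' by simp
  have eq: "d - d' = of_int k / (real p * real p')"
    unfolding d(1) d'(1) k_def using d(2) d'(2) by (simp add: diff_frac_eq)
  then have "k \<noteq> 0" using assms(3) by auto
  then have k: "1 \<le> \<bar>real_of_int k\<bar>" by linarith
  have "p * p' \<le> 2 ^ Suc j * 2 ^ Suc j" using d d' by (intro mult_mono) auto
  also have "\<dots> = 4 ^ Suc j" by (simp add: power_mult_distrib[symmetric])
  finally have "real (p * p') \<le> real (4 ^ Suc j)" by (simp only: of_nat_le_iff)
  then have "1 / 4 ^ Suc j \<le> 1 / (real p * real p')" using pp by (intro divide_left_mono) auto
  also have "\<dots> \<le> \<bar>of_int k\<bar> / (real p * real p')" using k pp by (intro divide_right_mono) auto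
  finally show ?thesis unfolding eq using pp by (simp add: abs_mult)
qed

lemma finite_ends: "finite (ends j)"
  by (induction j) (auto simp: finite_digits)

text \<open>Level i contributes a factor 2^(2(i+1)), and these exponents sum to j^2 + j over i <
  j.\<close>

lemma card_ends: "card (ends j) \<le> 2 ^ (j ^ 2 + j)"
proof (induction j)
  case (Suc j)
  have "card (ends (Suc j)) \<le> card (ends j \<times> digits j)"
    unfolding ends.simps using finite_ends finite_digits by (intro card_image_le) auto
  also have "\<dots> \<le> 2 ^ (j ^ 2 + j) * 4 ^ Suc j"
    unfolding card_cartesian_product using Suc card_digits by (intro mult_mono) auto
  also have "(4::nat) ^ Suc j = 2 ^ (2 * Suc j)" by (simp add: power_mult)
  also have "2 ^ (j ^ 2 + j) * (2::nat) ^ (2 * Suc j) = 2 ^ ((Suc j) ^ 2 + Suc j)"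
    unfolding power_add[symmetric] by (simp add: power2_eq_square)
  finally show ?case .
qed simp

text \<open>For equal c the digit gap is scaled by \<open>\<delta> j\<close>; for different c the
  gap \<open>4 * \<delta> j\<close> shrinks by at most \<open>\<delta> j\<close>. Comparing pairs
  rather than points also shows that a point determines its last digit. Separation at level j is
  assumed because this is the induction step of \<open>ends_sep\<close>.\<close>

lemma pair_sep:
  assumes sep: "\<And>c c'. c \<in> ends j \<Longrightarrow> c' \<in> ends j \<Longrightarrow> c \<noteq> c' \<Longrightarrow> 4 * \<delta> j \<le> \<bar>c - c'\<bar>"
    and "c \<in> ends j" "d \<in> digits j" "c' \<in> ends j" "d' \<in> digits j" "(c, d) \<noteq> (c', d')"
  shows "4 * \<delta> (Suc j) \<le> \<bar>(c + \<delta> j * d) - (c' + \<delta> j * d')\<bar>"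
proof (cases "c = c'")
  case True
  then have "1 / 4 ^ Suc j \<le> \<bar>d - d'\<bar>" using assms by (intro digits_sep) auto
  then have "\<delta> j * (1 / 4 ^ Suc j) \<le> \<delta> j * \<bar>d - d'\<bar>" using \<delta>_pos[of j] by (intro mult_left_mono) auto
  also have "\<dots> = \<bar>(c + \<delta> j * d) - (c' + \<delta> j * d')\<bar>"
    using True \<delta>_pos[of j] by (simp add: abs_mult right_diff_distrib[symmetric])
  also have "4 * \<delta> (Suc j) \<le> \<delta> j * (1 / 4 ^ Suc j)" using \<delta>_Suc[of j] by simp
  ultimately show ?thesis by linarith
next
  case False
  have "\<bar>\<delta> j * d - \<delta> j * d'\<bar> \<le> \<delta> j"
  proof -
    have "\<bar>d - d'\<bar> \<le> 1" using digits_range[OF assms(3)] digits_range[OF assms(5)] by linarith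
    then have "\<delta> j * \<bar>d - d'\<bar> \<le> \<delta> j * 1" using \<delta>_pos[of j] by (intro mult_left_mono) auto
    then show ?thesis using \<delta>_pos[of j] by (simp add: abs_mult right_diff_distrib[symmetric])
  qed
  moreover have "4 * \<delta> j \<le> \<bar>c - c'\<bar>" using False assms by blast
  ultimately show ?thesis using \<delta>_Suc_le[of j] \<delta>_pos[of j] by linarith
qed

lemma ends_sep:
  "c \<in> ends j \<Longrightarrow> c' \<in> ends j \<Longrightarrow> c \<noteq> c' \<Longrightarrow> 4 * \<delta> j \<le> \<bar>c - c'\<bar>"
proof (induction j arbitrary: c c')
  case (Suc j)
  obtain e d where e: "c = e + \<delta> j * d" "e \<in> ends j" "d \<in> digits j" using Suc.prems(1) by auto
  obtain e' d' where e': "c' = e' + \<delta> j * d'" "e' \<in> ends j" "d' \<in> digits j" using Suc.prems(2) by auto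
  show ?case unfolding e(1) e'(1)
    by (rule pair_sep[OF Suc.IH]) (use e e' Suc.prems(3) in auto)
qed simp

lemma nbhd_Suc: "nbhd (Suc j) \<subseteq> nbhd j"
proof
  fix x assume "x \<in> nbhd (Suc j)"
  then obtain c d where cd: "c \<in> ends j" "d \<in> digits j" "\<bar>x - (c + \<delta> j * d)\<bar> \<le> 3 / 2 * \<delta> (Suc j)"
    by (auto simp: nbhd_def)
  have "0 \<le> \<delta> j * d" "\<delta> j * d \<le> \<delta> j * 1"
    using digits_range[OF cd(2)] \<delta>_pos[of j] by (auto intro!: mult_left_mono)
  \<comment> \<open>A digit moves the point by at most \<open>\<delta> j\<close>, and 1 + (3/2)/4 is
    below 3/2.\<close>
  then have "\<bar>x - c\<bar> \<le> 3 / 2 * \<delta> j" using cd(3) \<delta>_Suc_le[of j] \<delta>_pos[of j] by linarith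
  then show "x \<in> nbhd j" using cd(1) by (auto simp: nbhd_def)
qed

lemma nbhd_antimono: "i \<le> j \<Longrightarrow> nbhd j \<subseteq> nbhd i"
  by (rule lift_Suc_antimono_le[of nbhd]) (use nbhd_Suc in auto)

section \<open>The digit functions and the continuity of f\<close>

lemma trapezoid_eq_0: "\<bar>u\<bar> \<ge> 3 / 2 \<Longrightarrow> trapezoid u = 0"
  by (simp add: trapezoid_def)

lemma trapezoid_eq_1: "\<bar>u\<bar> \<le> 4 / 3 \<Longrightarrow> trapezoid u = 1"
  by (simp add: trapezoid_def)

text \<open>All other bumps are centred at least \<open>4 * \<delta> (Suc j)\<close> away from this
  centre and have radius \<open>3 / 2 * \<delta> (Suc j)\<close>, so they vanish at x.\<close>

lemma digit_fun_eq:
  assumes "c \<in> ends j" "d \<in> digits j" "\<bar>x - (c + \<delta> j * d)\<bar> \<le> 3 / 2 * \<delta> (Suc j)"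
  shows "digit_fun j x = d * trapezoid ((x - (c + \<delta> j * d)) / \<delta> (Suc j))"
proof -
  let ?g = "\<lambda>(c, d). d * trapezoid ((x - (c + \<delta> j * d)) / \<delta> (Suc j))"
  have "?g cd = 0" if mem: "cd \<in> ends j \<times> digits j - {(c, d)}" for cd
  proof -
    obtain c' d' where cd: "cd = (c', d')" "c' \<in> ends j" "d' \<in> digits j" "(c, d) \<noteq> (c', d')"
      using mem by (cases cd) auto
    have "4 * \<delta> (Suc j) \<le> \<bar>(c + \<delta> j * d) - (c' + \<delta> j * d')\<bar>"
      using assms cd by (intro pair_sep ends_sep) auto
    then have "3 / 2 * \<delta> (Suc j) \<le> \<bar>x - (c' + \<delta> j * d')\<bar>" using assms(3) \<delta>_pos[of "Suc j"] by linarith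
    then have "3 / 2 \<le> \<bar>(x - (c' + \<delta> j * d')) / \<delta> (Suc j)\<bar>"
      using \<delta>_pos[of "Suc j"] by (simp add: abs_divide pos_le_divide_eq)
    then show ?thesis unfolding cd(1) by (simp add: trapezoid_eq_0)
  qed
  then have "(\<Sum>cd\<in>ends j \<times> digits j. ?g cd) = (\<Sum>cd\<in>{(c, d)}. ?g cd)"
    using assms finite_ends finite_digits by (intro sum.mono_neutral_right) auto
  then show ?thesis unfolding digit_fun_def by simp
qed

lemma digit_fun_outside:
  assumes "x \<notin> nbhd (Suc j)"
  shows "digit_fun j x = 0"
  unfolding digit_fun_def
proof (intro sum.neutral ballI)
  fix cd assume "cd \<in> ends j \<times> digits j"
  then obtain c d where cd: "cd = (c, d)" "c \<in> ends j" "d \<in> digits j" by auto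
  then have "3 / 2 * \<delta> (Suc j) < \<bar>x - (c + \<delta> j * d)\<bar>"
    using assms by (fastforce simp: nbhd_def not_le)
  then have "3 / 2 \<le> \<bar>(x - (c + \<delta> j * d)) / \<delta> (Suc j)\<bar>"
    using \<delta>_pos[of "Suc j"] by (simp add: abs_divide pos_le_divide_eq)
  then show "(case cd of (c, d) \<Rightarrow> d * trapezoid ((x - (c + \<delta> j * d)) / \<delta> (Suc j))) = 0"
    unfolding cd(1) by (simp add: trapezoid_eq_0)
qed

lemma abs_digit_fun_le: "\<bar>digit_fun j x\<bar> \<le> 1"
proof (cases "x \<in> nbhd (Suc j)")
  case True
  then obtain c d where cd: "c \<in> ends j" "d \<in> digits j" "\<bar>x - (c + \<delta> j * d)\<bar> \<le> 3 / 2 * \<delta> (Suc j)"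
    by (auto simp: nbhd_def)
  have "\<bar>d * trapezoid ((x - (c + \<delta> j * d)) / \<delta> (Suc j))\<bar> \<le> 1 * 1"
    unfolding abs_mult using digits_range[OF cd(2)] by (intro mult_mono) (auto simp: trapezoid_def)
  then show ?thesis unfolding digit_fun_eq[OF cd] by simp
qed (simp add: digit_fun_outside)

lemma continuous_digit_fun: "continuous_on A (digit_fun j)"
  unfolding digit_fun_def case_prod_beta
  using \<delta>_pos[of "Suc j"] by (intro continuous_intros) auto

lemma continuous_f: "continuous_on A f"
proof -
  have "uniform_limit A (\<lambda>n x. \<Sum>j<n. (1 / 2) ^ j * digit_fun j x) f sequentially"
    unfolding f_def
  proof (rule Weierstrass_m_test)
    show "norm ((1 / 2) ^ j * digit_fun j x) \<le> (1 / 2) ^ j" for j x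
      using abs_digit_fun_le[of j x] by (simp add: abs_mult power_abs mult_left_le)
  qed (simp add: summable_geometric)
  then show ?thesis
    by (rule uniform_limit_theorem[rotated])
      (auto intro!: continuous_intros continuous_digit_fun always_eventually)
qed

lemma graph_in_lines_partial: "graph_in_lines (\<lambda>x. \<Sum>j<J. (1 / 2) ^ j * digit_fun j x)"
  unfolding digit_fun_def case_prod_beta
  by (intro graph_in_lines_sum graph_in_lines_mult graph_in_lines_trapezoid) (auto simp: finite_ends finite_digits)

text \<open>The sets \<open>nbhd j\<close> are nested, so off \<open>nbhd J\<close> all later digit
  functions vanish. There f agrees with a finite sum to which \<open>graph_in_lines_partial\<close>
  applies.\<close>

lemma f_outside:
  assumes "x \<notin> nbhd J"
  shows "f x = (\<Sum>j<J. (1 / 2) ^ j * digit_fun j x)"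
  unfolding f_def
proof (rule suminf_finite)
  fix j assume "j \<notin> {..<J}"
  then have "x \<notin> nbhd (Suc j)" using nbhd_antimono[of J "Suc j"] assms by auto
  then show "(1 / 2) ^ j * digit_fun j x = 0" by (simp add: digit_fun_outside)
qed simp

subsection \<open>The measure on its graph\<close>

definition digit_pmf :: "nat \<Rightarrow> real pmf" where
  "digit_pmf j = pmf_of_set (small_primes j) \<bind> (\<lambda>p. map_pmf (\<lambda>n. real n / real p) (pmf_of_set {..<p}))"

definition digit_char :: "nat \<Rightarrow> real \<Rightarrow> complex" where
  "digit_char j l = (LINT x|measure_pmf (digit_pmf j). cis (- (2 * pi * l * x)))"

definition \<Omega> :: "(nat \<Rightarrow> real) measure" where
  "\<Omega> = PiM UNIV (\<lambda>j. measure_pmf (digit_pmf j))"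

definition point :: "(nat \<Rightarrow> real) \<Rightarrow> real \<times> real" where
  "point \<omega> = (\<Sum>j. \<delta> j * \<omega> j, \<Sum>j. (1 / 2) ^ j * \<omega> j)"

definition salem_measure :: "(real \<times> real) measure" where
  "salem_measure = distr \<Omega> borel point"

section \<open>Fourier transforms of the digit laws\<close>

lemma small_primes_ne: "small_primes j \<noteq> {}"
  using two_in_small_primes by blast

lemma set_digit_pmf: "set_pmf (digit_pmf j) \<subseteq> digits j"
proof -
  have "{..<p} \<noteq> {}" if "p \<in> small_primes j" for p
    using small_primes_pos[OF that] by auto
  then show ?thesis unfolding digit_pmf_def digits_def
    by (auto simp: set_pmf_of_set finite_small_primes small_primes_ne)
qed

lemma digit_char_eq: "digit_char j l = (\<Sum>p\<in>small_primes j. lattice_mean p (- l)) / of_nat (card (small_primes j))"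
proof -
  have ne: "{..<p} \<noteq> {}" if "p \<in> small_primes j" for p
    using small_primes_pos[OF that] by auto
  have "digit_char j l = (\<Sum>p\<in>small_primes j. (LINT n|measure_pmf (pmf_of_set {..<p}). cis (- (2 * pi * l * (real n / real p)))) /\<^sub>R real (card (small_primes j)))"
    unfolding digit_char_def digit_pmf_def
    using ne by (subst pmf_expectation_bind_pmf_of_set) (auto simp: finite_small_primes small_primes_ne set_pmf_of_set)
  also have "\<dots> = (\<Sum>p\<in>small_primes j. lattice_mean p (- l) /\<^sub>R real (card (small_primes j)))"
  proof (intro sum.cong refl)
    fix p assume p: "p \<in> small_primes j"
    have "(LINT n|measure_pmf (pmf_of_set {..<p}). cis (- (2 * pi * l * (real n / real p)))) = lattice_mean p (- l)"
      using ne[OF p] by (subst integral_measure_pmf[of "{..<p}"])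
        (auto simp: lattice_mean_def scaleR_conv_of_real sum_divide_distrib)
    then show "(LINT n|measure_pmf (pmf_of_set {..<p}). cis (- (2 * pi * l * (real n / real p)))) /\<^sub>R real (card (small_primes j))
      = lattice_mean p (- l) /\<^sub>R real (card (small_primes j))" by (simp only:)
  qed
  also have "\<dots> = (\<Sum>p\<in>small_primes j. lattice_mean p (- l)) / of_nat (card (small_primes j))"
    unfolding scaleR_sum_right[symmetric] by (simp add: scaleR_conv_of_real divide_inverse mult.commute)
  finally show ?thesis .
qed

lemma norm_digit_char_le_1: "norm (digit_char j l) \<le> 1"
proof -
  have "norm (digit_char j l) \<le> (LINT x|measure_pmf (digit_pmf j). norm (cis (- (2 * pi * l * x))))"
    unfolding digit_char_def by (rule integral_norm_bound)
  then show ?thesis by simp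
qed

text \<open>Apply \<open>sum_norm_lattice_mean_le\<close> with N = 2^(j+1), where N + 2 <= 2^(j+2),
  and divide by the number of primes, which is at least 2^j/(j+1). One factor j + 3 comes from the
  harmonic number, the other from the prime count.\<close>

lemma norm_digit_char_le:
  assumes "\<bar>l\<bar> \<ge> 2 ^ (j + 2)"
  shows "norm (digit_char j l) \<le> 4 * (real j + 3) ^ 2 * log 2 (2 * \<bar>l\<bar>) / 2 ^ j"
proof -
  define P where "P = small_primes j"
  have l1: "\<bar>l\<bar> \<ge> 1" using assms one_le_power[of "2::real" "j + 2"] by linarith
  have cardP: "2 ^ j \<le> real (Suc j) * real (card P)"
  proof -
    have "2 ^ j \<le> Suc j * card P" using prime_count_two_power[of "Suc j"] by (simp add: P_def small_primes_def)
    then have "real (2 ^ j) \<le> real (Suc j * card P)" by (simp only: of_nat_le_iff)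
    then show ?thesis by (simp only: of_nat_mult of_nat_power of_nat_numeral)
  qed
  have P0: "real (card P) > 0" using small_primes_ne finite_small_primes by (simp add: P_def card_gt_0_iff)
  have "(\<Sum>p\<in>P. norm (lattice_mean p (- l))) \<le> 4 * log 2 (2 * \<bar>- l\<bar>) * harm (Suc (2 ^ Suc j))"
  proof (rule sum_norm_lattice_mean_le)
    have "real (2 ^ Suc j) + 2 \<le> 2 ^ (j + 2)" using one_le_power[of "2::real" j] by simp
    also note assms
    finally show "real (2 ^ Suc j) + 2 \<le> \<bar>- l\<bar>" by simp
  qed (auto simp: P_def small_primes_def)
  also have "\<dots> \<le> 4 * log 2 (2 * \<bar>l\<bar>) * (real j + 3)"
  proof -
    have "ln (real (Suc (2 ^ Suc j))) \<le> ln (2 ^ (j + 2))"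
    proof (rule ln_mono)
      have "(1::real) \<le> 2 ^ j" by simp
      then show "real (Suc (2 ^ Suc j)) \<le> 2 ^ (j + 2)" by (simp del: one_le_power)
    qed (simp only: of_nat_0_less_iff zero_less_Suc)
    also have "\<dots> = real (j + 2) * ln 2" by (rule ln_realpow)
    also have "\<dots> \<le> real (j + 2) * 1" using ln_2_less_1 by (intro mult_left_mono) auto
    finally have "harm (Suc (2 ^ Suc j)) \<le> real j + 3"
      using harm_le_ln_add_1[of "Suc (2 ^ Suc j)"] by simp
    moreover have "0 \<le> 4 * log 2 (2 * \<bar>l\<bar>)" using l1 by simp
    ultimately show ?thesis unfolding abs_minus_cancel by (rule mult_left_mono)
  qed
  finally have sum_le: "(\<Sum>p\<in>P. norm (lattice_mean p (- l))) \<le> 4 * log 2 (2 * \<bar>l\<bar>) * (real j + 3)" .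
  have log0: "log 2 (2 * \<bar>l\<bar>) \<ge> 0" using l1 by simp
  have "norm (digit_char j l) \<le> (\<Sum>p\<in>P. norm (lattice_mean p (- l))) / real (card P)"
    unfolding digit_char_eq P_def norm_divide by (simp add: divide_right_mono norm_sum)
  also have "\<dots> \<le> 4 * log 2 (2 * \<bar>l\<bar>) * (real j + 3) / real (card P)"
    using sum_le by (intro divide_right_mono) auto
  also have "\<dots> \<le> 4 * log 2 (2 * \<bar>l\<bar>) * (real j + 3) * ((real j + 3) / 2 ^ j)"
  proof -
    have "1 / real (card P) \<le> real (Suc j) / 2 ^ j" using cardP P0 by (simp add: field_simps)
    also have "\<dots> \<le> (real j + 3) / 2 ^ j" by (intro divide_right_mono) auto
    finally have "4 * log 2 (2 * \<bar>l\<bar>) * (real j + 3) * (1 / real (card P)) \<le> 4 * log 2 (2 * \<bar>l\<bar>) * (real j + 3) * ((real j + 3) / 2 ^ j)"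
      using log0 by (intro mult_left_mono) auto
    then show ?thesis by simp
  qed
  finally show ?thesis by (simp add: power2_eq_square mult.commute mult.left_commute)
qed

section \<open>The product space and the transform of the measure\<close>

sublocale Q: product_prob_space "\<lambda>j. measure_pmf (digit_pmf j)" "UNIV :: nat set"
  by (intro product_prob_spaceI measure_pmf.prob_space_axioms)

lemma prob_space_\<Omega>: "prob_space \<Omega>"
  unfolding \<Omega>_def by (rule Q.prob_space_axioms)

lemma measurable_coord [measurable]: "(\<lambda>\<omega>. \<omega> j) \<in> borel_measurable \<Omega>"
proof -
  have "(\<lambda>\<omega>. \<omega> j) \<in> measurable \<Omega> (measure_pmf (digit_pmf j))"
    unfolding \<Omega>_def by (rule measurable_component_singleton) simp
  moreover have "id \<in> measurable (measure_pmf (digit_pmf j)) borel" by simp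
  ultimately have "id \<circ> (\<lambda>\<omega>. \<omega> j) \<in> borel_measurable \<Omega>" by (rule measurable_comp)
  then show ?thesis by (simp add: comp_def)
qed

lemma AE_digits: "AE \<omega> in \<Omega>. \<forall>j. \<omega> j \<in> digits j"
proof (subst AE_all_countable, rule allI)
  fix j
  have "AE x in measure_pmf (digit_pmf j). x \<in> digits j"
    using set_digit_pmf by (auto simp: AE_measure_pmf_iff)
  then show "AE \<omega> in \<Omega>. \<omega> j \<in> digits j" unfolding \<Omega>_def by (intro Q.AE_component) auto
qed

lemma measurable_point [measurable]: "point \<in> borel_measurable \<Omega>"
  unfolding point_def by measurable

lemma integral_prod_\<Omega>:
  fixes g :: "nat \<Rightarrow> real \<Rightarrow> complex"
  assumes "\<And>j. integrable (measure_pmf (digit_pmf j)) (g j)"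
  shows "(LINT \<omega>|\<Omega>. (\<Prod>j<n. g j (\<omega> j))) = (\<Prod>j<n. (LINT x|measure_pmf (digit_pmf j). g j x))"
proof -
  let ?M = "\<lambda>j. measure_pmf (digit_pmf j)"
  have "(LINT \<omega>|\<Omega>. (\<Prod>j<n. g j (\<omega> j))) = (LINT \<omega>|\<Omega>. (\<Prod>j<n. g j (restrict \<omega> {..<n} j)))"
    by simp
  also have "\<dots> = (LINT x|distr \<Omega> (PiM {..<n} ?M) (\<lambda>\<omega>. restrict \<omega> {..<n}). (\<Prod>j<n. g j (x j)))"
  proof (rule integral_distr[symmetric])
    show "(\<lambda>\<omega>. restrict \<omega> {..<n}) \<in> measurable \<Omega> (PiM {..<n} ?M)"
      unfolding \<Omega>_def by (rule measurable_restrict_subset) simp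
    have "(\<lambda>x. g j (x j)) \<in> borel_measurable (PiM {..<n} ?M)" if "j < n" for j
    proof -
      have "(\<lambda>x. x j) \<in> measurable (PiM {..<n} ?M) (?M j)"
        using that by (intro measurable_component_singleton) simp
      moreover have "g j \<in> borel_measurable (?M j)" by simp
      ultimately show ?thesis by (rule measurable_compose)
    qed
    then show "(\<lambda>x. \<Prod>j<n. g j (x j)) \<in> borel_measurable (PiM {..<n} ?M)"
      by (intro borel_measurable_prod) auto
  qed
  also have "distr \<Omega> (PiM {..<n} ?M) (\<lambda>\<omega>. restrict \<omega> {..<n}) = PiM {..<n} ?M"
    unfolding \<Omega>_def by (rule Q.distr_PiM_restrict_finite) auto
  also have "(LINT x|PiM {..<n} ?M. (\<Prod>j<n. g j (x j))) = (\<Prod>j<n. (LINT x|?M j. g j x))"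
    using assms by (intro Q.product_integral_prod) auto
  finally show ?thesis .
qed

lemma cis_sum: "finite A \<Longrightarrow> cis (\<Sum>i\<in>A. g i) = (\<Prod>i\<in>A. cis (g i))"
  by (induction A rule: finite_induct) (simp_all add: cis_mult[symmetric])

lemma summable_digits:
  assumes "\<And>j. \<omega> j \<in> digits j"
  shows "summable (\<lambda>j. \<delta> j * \<omega> j)" "summable (\<lambda>j. (1 / 2) ^ j * \<omega> j)"
proof -
  have w: "\<bar>\<omega> j\<bar> \<le> 1" for j using digits_range[OF assms[of j]] by simp
  show "summable (\<lambda>j. \<delta> j * \<omega> j)"
  proof (rule summable_comparison_test')
    show "summable (\<lambda>j. (1 / 4 :: real) ^ j)" by (simp add: summable_geometric)
    fix j
    have "\<bar>\<delta> j\<bar> * \<bar>\<omega> j\<bar> \<le> (1 / 4) ^ j * 1"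
      using w \<delta>_add_le[of 0 j] \<delta>_pos[of j] by (intro mult_mono) (auto simp: \<delta>_0)
    then show "norm (\<delta> j * \<omega> j) \<le> (1 / 4) ^ j" by (simp add: abs_mult)
  qed
  show "summable (\<lambda>j. (1 / 2) ^ j * \<omega> j)"
  proof (rule summable_comparison_test')
    show "summable (\<lambda>j. (1 / 2 :: real) ^ j)" by (simp add: summable_geometric)
    fix j
    show "norm ((1 / 2) ^ j * \<omega> j) \<le> (1 / 2) ^ j"
      using w by (simp add: abs_mult mult_left_le power_abs)
  qed
qed

lemma fourier_transform_salem_measure_le:
  "cmod (fourier_transform salem_measure (\<xi>, \<eta>)) \<le> (\<Prod>j<J. norm (digit_char j (\<delta> j * \<xi> + (1 / 2) ^ j * \<eta>)))"
proof -
  interpret prob_space \<Omega> by (rule prob_space_\<Omega>)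
  define l where "l j = \<delta> j * \<xi> + (1 / 2) ^ j * \<eta>" for j
  define E where "E n \<omega> = cis (- (2 * pi * (\<Sum>j<n. l j * \<omega> j)))" for n \<omega>
  have E_prod: "E n \<omega> = (\<Prod>j<n. cis (- (2 * pi * l j * \<omega> j)))" for n \<omega>
    unfolding E_def by (subst cis_sum[symmetric]) (auto simp: sum_distrib_left sum_negf[symmetric] mult.assoc)
  have int_E: "(LINT \<omega>|\<Omega>. E n \<omega>) = (\<Prod>j<n. digit_char j (l j))" for n
    unfolding E_prod digit_char_def
    by (intro integral_prod_\<Omega> measure_pmf.integrable_const_bound[where B = 1]) auto
  have "(\<lambda>n. LINT \<omega>|\<Omega>. E n \<omega>) \<longlonglongrightarrow> (LINT \<omega>|\<Omega>. cis (- (2 * pi * (point \<omega> \<bullet> (\<xi>, \<eta>)))))"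
  proof (rule integral_dominated_convergence[where w = "\<lambda>_. 1"])
    show "(\<lambda>\<omega>. cis (- (2 * pi * (point \<omega> \<bullet> (\<xi>, \<eta>))))) \<in> borel_measurable \<Omega>"
      unfolding cis_conv_exp by measurable
    show "E n \<in> borel_measurable \<Omega>" for n
      unfolding E_def cis_conv_exp by measurable
    show "AE \<omega> in \<Omega>. (\<lambda>n. E n \<omega>) \<longlonglongrightarrow> cis (- (2 * pi * (point \<omega> \<bullet> (\<xi>, \<eta>))))"
      using AE_digits
    proof eventually_elim
      case (elim \<omega>)
      then have sm: "summable (\<lambda>j. \<delta> j * \<omega> j)" "summable (\<lambda>j. (1 / 2) ^ j * \<omega> j)"
        using summable_digits by auto
      have "(\<lambda>j. (\<delta> j * \<omega> j) * \<xi> + ((1 / 2) ^ j * \<omega> j) * \<eta>) sums (point \<omega> \<bullet> (\<xi>, \<eta>))"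
        unfolding point_def inner_Pair inner_real_def
        by (intro sums_add sums_mult2 summable_sums sm)
      then have "(\<lambda>n. \<Sum>j<n. l j * \<omega> j) \<longlonglongrightarrow> point \<omega> \<bullet> (\<xi>, \<eta>)"
        unfolding sums_def l_def by (simp add: algebra_simps)
      then show ?case unfolding E_def cis_conv_exp by (intro tendsto_intros)
    qed
    show "AE \<omega> in \<Omega>. norm (E n \<omega>) \<le> 1" for n by (simp add: E_def)
  qed simp
  also have "(LINT \<omega>|\<Omega>. cis (- (2 * pi * (point \<omega> \<bullet> (\<xi>, \<eta>))))) = fourier_transform salem_measure (\<xi>, \<eta>)"
    unfolding fourier_transform_cis salem_measure_def cis_conv_exp by (subst integral_distr) auto
  finally have lim: "(\<lambda>n. cmod (\<Prod>j<n. digit_char j (l j))) \<longlonglongrightarrow> cmod (fourier_transform salem_measure (\<xi>, \<eta>))"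
    unfolding int_E by (intro tendsto_norm)
  have "cmod (\<Prod>j<n. digit_char j (l j)) \<le> (\<Prod>j<J. norm (digit_char j (l j)))" if "n \<ge> J" for n
  proof -
    have "{..<n} = {..<J} \<union> {J..<n}" using that by auto
    then have "cmod (\<Prod>j<n. digit_char j (l j)) = (\<Prod>j\<in>{..<J} \<union> {J..<n}. norm (digit_char j (l j)))"
      by (simp only: prod_norm)
    also have "\<dots> = (\<Prod>j<J. norm (digit_char j (l j))) * (\<Prod>j\<in>{J..<n}. norm (digit_char j (l j)))"
      by (intro prod.union_disjoint) auto
    also have "\<dots> \<le> (\<Prod>j<J. norm (digit_char j (l j))) * 1"
      using norm_digit_char_le_1 by (intro mult_left_mono prod_le_1 prod_nonneg) auto
    finally show ?thesis by simp
  qed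
  then have "cmod (fourier_transform salem_measure (\<xi>, \<eta>)) \<le> (\<Prod>j<J. norm (digit_char j (l j)))"
    by (intro LIMSEQ_le_const2[OF lim]) auto
  then show ?thesis by (simp add: l_def)
qed

section \<open>The measure lives on the graph\<close>

lemma point_in_graph:
  assumes \<omega>: "\<And>j. \<omega> j \<in> digits j"
  shows "point \<omega> \<in> graph_on {0..1} f"
proof -
  define X where "X = (\<Sum>j. \<delta> j * \<omega> j)"
  define c where "c J = (\<Sum>j<J. \<delta> j * \<omega> j)" for J
  have term_le: "\<delta> (i + J) * \<omega> (i + J) \<le> \<delta> J * (1 / 4) ^ i" for i J
  proof -
    have "\<delta> (i + J) * \<omega> (i + J) \<le> (\<delta> J * (1 / 4) ^ i) * 1"
      using \<delta>_add_le[of J i] \<delta>_pos[of J] digits_range[OF \<omega>] by (intro mult_mono) (auto simp: add.commute)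
    then show ?thesis by simp
  qed
  have term_ge: "0 \<le> \<delta> j * \<omega> j" for j
    using \<delta>_pos[of j] digits_range[OF \<omega>] by (intro mult_nonneg_nonneg) (auto simp: less_imp_le)
  have c_ends: "c J \<in> ends J" for J
    by (induction J) (use \<omega> in \<open>auto simp: c_def intro!: image_eqI\<close>)
  have X_split: "X = (\<Sum>i. \<delta> (i + J) * \<omega> (i + J)) + c J" for J
    unfolding X_def c_def using summable_digits(1)[of \<omega>] \<omega> by (intro suminf_split_initial_segment) auto
  have sm: "summable (\<lambda>i. \<delta> (i + J) * \<omega> (i + J))" for J
    using summable_digits(1)[of \<omega>] \<omega> by (intro summable_ignore_initial_segment) auto
  have X_ge: "c J \<le> X" for J
    using X_split[of J] suminf_nonneg[OF sm[of J]] term_ge by simp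
  \<comment> \<open>The tail is dominated by a geometric series of ratio 1/4, whence the
    4/3.\<close>
  have X_le: "X \<le> c J + 4 / 3 * \<delta> J" for J
  proof -
    have "(\<Sum>i. \<delta> (i + J) * \<omega> (i + J)) \<le> (\<Sum>i. \<delta> J * (1 / 4) ^ i)"
      using term_le sm by (intro suminf_le summable_mult summable_geometric) auto
    also have "\<dots> = \<delta> J * (\<Sum>i. (1 / 4) ^ i)"
      by (intro suminf_mult summable_geometric) auto
    also have "\<dots> = 4 / 3 * \<delta> J" by (simp add: suminf_geometric)
    finally show ?thesis using X_split[of J] by simp
  qed
  \<comment> \<open>X lies on the plateau of the bump centred at \<open>c (Suc j)\<close>, so every
    digit is read off exactly and f X is the second coordinate of the point.\<close>
  have digit: "digit_fun j X = \<omega> j" for j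
  proof -
    have c_Suc: "c (Suc j) = c j + \<delta> j * \<omega> j" by (simp add: c_def)
    have le: "\<bar>X - (c j + \<delta> j * \<omega> j)\<bar> \<le> 4 / 3 * \<delta> (Suc j)"
      using X_ge[of "Suc j"] X_le[of "Suc j"] unfolding c_Suc by simp
    then have "\<bar>(X - (c j + \<delta> j * \<omega> j)) / \<delta> (Suc j)\<bar> \<le> 4 / 3"
      using \<delta>_pos[of "Suc j"] by (simp add: abs_divide pos_divide_le_eq)
    moreover have "digit_fun j X = \<omega> j * trapezoid ((X - (c j + \<delta> j * \<omega> j)) / \<delta> (Suc j))"
      using le \<delta>_pos[of "Suc j"] c_ends \<omega> by (intro digit_fun_eq) auto
    ultimately show ?thesis by (simp add: trapezoid_eq_1)
  qed
  have "0 \<le> X" using X_ge[of 0] by (simp add: c_def)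
  moreover have "X \<le> 1"
  proof -
    \<comment> \<open>The sharper digit bound is needed here: the first digit is at most 1/2, and
      the rest adds at most (4/3)(1/4).\<close>
    have "c 1 \<le> 1 / 2" using digits_range(2)[OF \<omega>[of 0]] by (simp add: c_def \<delta>_0)
    moreover have "\<delta> 1 \<le> 1 / 4" using \<delta>_Suc_le[of 0] by (simp add: \<delta>_0)
    ultimately show ?thesis using X_le[of 1] by simp
  qed
  moreover have "point \<omega> = (X, f X)" unfolding point_def f_def digit by (simp add: X_def)
  ultimately show ?thesis unfolding graph_on_def by auto
qed

lemma salem_measure_on_graph: "salem_measure \<in> prob_measures_on (graph_on {0..1} f)"
proof -
  have "borel_prob_measure salem_measure"
    unfolding borel_prob_measure_def salem_measure_def
    using prob_space.prob_space_distr[OF prob_space_\<Omega> measurable_point] by simp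
  moreover have closed: "closed (graph_on {0..1} f)"
  proof -
    have "graph_on {0..1} f = (\<lambda>x. (x, f x)) ` {0..1}" by (auto simp: graph_on_def)
    moreover have "compact ((\<lambda>x. (x, f x)) ` {0..1})"
      by (intro compact_continuous_image continuous_intros continuous_f) auto
    ultimately show ?thesis by (simp add: compact_imp_closed)
  qed
  moreover have "AE z in salem_measure. z \<in> graph_on {0..1} f"
    unfolding salem_measure_def
  proof (subst AE_distr_iff)
    show "{x \<in> space borel. x \<in> graph_on {0..1} f} \<in> sets borel" using closed by simp
    show "AE \<omega> in \<Omega>. point \<omega> \<in> graph_on {0..1} f"
      using AE_digits by eventually_elim (simp add: point_in_graph)
  qed simp
  ultimately show ?thesis
    unfolding prob_measures_on_def using spt_subset_closed[of salem_measure, OF _ closed]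
    by (simp add: borel_prob_measure_def)
qed

section \<open>Decay of the transform at all frequencies\<close>

text \<open>Small values of two forms \<open>i < j\<close> would bound both coordinates, as \<open>\<delta>\<^sub>j 2\<^sup>j\<close> is much smaller than \<open>\<delta>\<^sub>i 2\<^sup>i\<close>.\<close>

lemma card_small_forms_le_1:
  assumes R: "2 powr (\<sigma> * (real J ^ 2 + 3 * real J)) \<le> max \<bar>\<xi>\<bar> \<bar>\<eta>\<bar>"
  shows "card {j \<in> {..<J}. \<bar>\<delta> j * \<xi> + (1 / 2) ^ j * \<eta>\<bar> < 2 ^ (j + 2)} \<le> 1"
proof -
  \<comment> \<open>Multiplied by 2^j, form j becomes \<open>\<rho> j * \<xi> + \<eta>\<close>. The
    coefficient of \<eta> no longer depends on j, so subtracting two forms eliminates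
    \<eta>.\<close>
  define \<rho> where "\<rho> j = \<delta> j * 2 ^ j" for j
  have \<rho>_pos: "\<rho> j > 0" for j using \<delta>_pos by (simp add: \<rho>_def)
  have \<rho>_Suc: "\<rho> (Suc j) \<le> \<rho> j / 8" for j
  proof -
    have "\<delta> (Suc j) \<le> \<delta> j / 4 ^ (j + 2)" by (rule \<delta>_Suc)
    also have "\<dots> \<le> \<delta> j / 4 ^ 2" using \<delta>_pos[of j] by (intro divide_left_mono power_increasing) auto
    finally show ?thesis by (simp add: \<rho>_def)
  qed
  have \<rho>_mono: "\<rho> j \<le> \<rho> i" if "i \<le> j" for i j
    using that by (rule lift_Suc_antimono_le[rotated]) (use \<rho>_Suc \<rho>_pos in \<open>simp add: order_trans[OF \<rho>_Suc] less_imp_le\<close>)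
  have False if ij: "i < j" "j < J" and small: "\<And>k. k \<in> {i, j} \<Longrightarrow> \<bar>\<delta> k * \<xi> + (1 / 2) ^ k * \<eta>\<bar> < 2 ^ (k + 2)" for i j
  proof -
    \<comment> \<open>J - 2 is the largest value of i. The exponents of \<open>1 / \<delta>\<close>
      at J and at K differ by \<sigma> (4K + 10), which will make
      \<open>\<rho> i * \<bar>\<xi>\<bar>\<close> too large.\<close>
    define K where "K = J - 2"
    have K: "J = K + 2" using ij by (simp add: K_def)
    have form: "\<bar>\<rho> k * \<xi> + \<eta>\<bar> < 4 * 4 ^ J" if "k \<in> {i, j}" for k
    proof -
      have "\<bar>\<rho> k * \<xi> + \<eta>\<bar> = 2 ^ k * \<bar>\<delta> k * \<xi> + (1 / 2) ^ k * \<eta>\<bar>"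
      proof -
        have "\<rho> k * \<xi> + \<eta> = 2 ^ k * (\<delta> k * \<xi> + (1 / 2) ^ k * \<eta>)"
          by (simp add: \<rho>_def power_divide distrib_left)
        then show ?thesis by (simp only: abs_mult power_abs abs_numeral)
      qed
      also have "\<dots> < 2 ^ k * 2 ^ (k + 2)" using small[OF that] by simp
      also have "\<dots> = 4 * 4 ^ k" by (simp add: power_mult_distrib[symmetric] power_add)
      also have "\<dots> \<le> 4 * 4 ^ J" using that ij by (intro mult_left_mono power_increasing) auto
      finally show ?thesis .
    qed
    \<comment> \<open>The difference of the forms is at least 7/8 of
      \<open>\<rho> i * \<bar>\<xi>\<bar>\<close> and below 8 times 4^J, which gives the constant
      10; then |\<eta>| is below 4 + 10 = 14 times 4^J.\<close>
    have "\<rho> j \<le> \<rho> i / 8" using \<rho>_mono[of "Suc i" j] \<rho>_Suc[of i] ij by simp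
    then have "\<rho> j * \<bar>\<xi>\<bar> \<le> \<rho> i / 8 * \<bar>\<xi>\<bar>" by (intro mult_right_mono) auto
    moreover have "\<rho> i * \<bar>\<xi>\<bar> - \<rho> j * \<bar>\<xi>\<bar> \<le> \<bar>\<rho> i * \<xi> - \<rho> j * \<xi>\<bar>"
      using \<rho>_pos[of i] \<rho>_pos[of j] abs_triangle_ineq2[of "\<rho> i * \<xi>" "\<rho> j * \<xi>"] by (simp add: abs_mult)
    moreover have "\<bar>\<rho> i * \<xi> - \<rho> j * \<xi>\<bar> < 8 * 4 ^ J" using form[of i] form[of j] by auto
    ultimately have \<xi>_small: "\<rho> i * \<bar>\<xi>\<bar> < 10 * 4 ^ J" by linarith
    have "\<bar>\<eta>\<bar> \<le> \<bar>\<rho> i * \<xi> + \<eta>\<bar> + \<rho> i * \<bar>\<xi>\<bar>"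
      using abs_triangle_ineq[of "\<rho> i * \<xi> + \<eta>" "- (\<rho> i * \<xi>)"] \<rho>_pos[of i] by (simp add: abs_mult)
    then have \<eta>_small: "\<bar>\<eta>\<bar> < 14 * 4 ^ J" using form[of i] \<xi>_small by auto
    have pow: "(64::real) * 4 ^ J \<le> 2 ^ (5 * K + 10)"
    proof -
      have "(64::real) * 4 ^ J = 1024 * 4 ^ K * 1" by (simp add: K)
      also have "\<dots> \<le> 1024 * 4 ^ K * 8 ^ K" by (intro mult_left_mono) auto
      also have "\<dots> = 2 ^ (5 * K + 10)"
        by (simp add: power_add power_mult power_mult_distrib[symmetric])
      finally show ?thesis .
    qed
    \<comment> \<open>So \<eta> is too small to attain the assumed maximum, and \<xi> must attain
      it.\<close>
    have "(14::real) * 4 ^ J < 2 powr (\<sigma> * (real J ^ 2 + 3 * real J))"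
    proof -
      have "(14::real) * 4 ^ J < 64 * 4 ^ J" by simp
      also have "\<dots> \<le> 2 ^ (5 * K + 10)" by (rule pow)
      also have "\<dots> = 2 powr (5 * real K + 10)" by (subst powr_realpow[symmetric]) auto
      also have "\<dots> \<le> 2 powr (1 * (real J ^ 2 + 3 * real J))"
        by (intro powr_mono) (auto simp: K power2_eq_square algebra_simps)
      also have "\<dots> \<le> 2 powr (\<sigma> * (real J ^ 2 + 3 * real J))"
        using \<sigma>_ge by (intro powr_mono mult_right_mono) auto
      finally show ?thesis .
    qed
    with R \<eta>_small have R\<xi>: "2 powr (\<sigma> * (real J ^ 2 + 3 * real J)) \<le> \<bar>\<xi>\<bar>" by linarith
    have "10 * 4 ^ J < (2::real) ^ (5 * K + 10)" using pow by (rule less_le_trans[rotated]) simp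
    also have "\<dots> = 2 ^ K * 2 powr (4 * real K + 10)"
      by (simp add: powr_realpow[symmetric] powr_add[symmetric])
    also have "\<dots> \<le> 2 ^ K * 2 powr (\<sigma> * (4 * real K + 10))"
      using \<sigma>_ge mult_right_mono[of 1 \<sigma> "4 * real K + 10"] by (intro mult_left_mono powr_mono) auto
    also have "\<dots> = \<rho> K * 2 powr (\<sigma> * (real J ^ 2 + 3 * real J))"
      unfolding \<rho>_def \<delta>_def by (simp add: K powr_add[symmetric] power2_eq_square algebra_simps)
    also have "\<dots> \<le> \<rho> i * \<bar>\<xi>\<bar>"
      using R\<xi> \<rho>_mono[of i K] \<rho>_pos[of i] ij K by (intro mult_mono) auto
    finally show False using \<xi>_small by simp
  qed
  then have "i = j" if "i \<in> {j \<in> {..<J}. \<bar>\<delta> j * \<xi> + (1 / 2) ^ j * \<eta>\<bar> < 2 ^ (j + 2)}"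
    "j \<in> {j \<in> {..<J}. \<bar>\<delta> j * \<xi> + (1 / 2) ^ j * \<eta>\<bar> < 2 ^ (j + 2)}" for i j
    using that by (cases i j rule: linorder_cases) auto
  then show ?thesis by (subst One_nat_def, subst card_le_Suc0_iff_eq) auto
qed

text \<open>Each j < J with a large form contributes at most B / 2^j, where W bounds the logarithm
  of the frequency by means of \<open>hi\<close>. The one possible exception has only the trivial
  bound 1, at the cost of a factor 2^J. The factors 2^(-j) multiply to 2^(-J(J-1)/2).\<close>

lemma fourier_transform_salem_measure_le_scale:
  assumes lo: "2 powr (\<sigma> * (real J ^ 2 + 3 * real J)) \<le> max \<bar>\<xi>\<bar> \<bar>\<eta>\<bar>"
    and hi: "max \<bar>\<xi>\<bar> \<bar>\<eta>\<bar> < 2 powr (\<sigma> * (real (Suc J) ^ 2 + 3 * real (Suc J)))"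
  shows "cmod (fourier_transform salem_measure (\<xi>, \<eta>))
    \<le> (4 * (real J + 3) ^ 2 * (2 + \<sigma> * (real J ^ 2 + 5 * real J + 4))) powr real J
      * 2 powr (- (real J * (real J - 1) / 2)) * 2 powr real J"
proof -
  define R where "R = max \<bar>\<xi>\<bar> \<bar>\<eta>\<bar>"
  define W where "W = 2 + \<sigma> * (real J ^ 2 + 5 * real J + 4)"
  define B where "B = 4 * (real J + 3) ^ 2 * W"
  define l where "l j = \<delta> j * \<xi> + (1 / 2) ^ j * \<eta>" for j
  define bad where "bad j \<longleftrightarrow> \<bar>l j\<bar> < 2 ^ (j + 2)" for j
  have W1: "W \<ge> 1" using \<sigma>_ge by (simp add: W_def add_increasing2)
  have B1: "B \<ge> 1"
  proof -
    have "1 * 1 \<le> (4 * (real J + 3) ^ 2) * W"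
    proof (rule mult_mono)
      have "1 \<le> (real J + 3) ^ 2" by (intro one_le_power) simp
      then show "1 \<le> 4 * (real J + 3) ^ 2" by linarith
    qed (use W1 in auto)
    then show ?thesis by (simp add: B_def)
  qed
  have factor: "norm (digit_char j (l j)) \<le> B / 2 ^ j * (if bad j then 2 ^ J else 1)" if j: "j < J" for j
  proof (cases "bad j")
    case True
    have "(1::real) \<le> 2 ^ J / 2 ^ j" using j by (simp add: power_increasing)
    also have "\<dots> \<le> B * (2 ^ J / 2 ^ j)" using mult_right_mono[OF B1, of "2 ^ J / 2 ^ j"] by simp
    finally have "norm (digit_char j (l j)) \<le> B * (2 ^ J / 2 ^ j)"
      by (rule order_trans[OF norm_digit_char_le_1])
    then show ?thesis using True by simp
  next
    case False
    then have large: "\<bar>l j\<bar> \<ge> 2 ^ (j + 2)" by (simp add: bad_def)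
    have l1: "\<bar>l j\<bar> \<ge> 1" using large one_le_power[of "2::real" "j + 2"] by linarith
    have "\<bar>l j\<bar> \<le> \<delta> j * \<bar>\<xi>\<bar> + (1 / 2) ^ j * \<bar>\<eta>\<bar>"
      unfolding l_def using abs_triangle_ineq[of "\<delta> j * \<xi>" "(1 / 2) ^ j * \<eta>"] \<delta>_pos[of j]
      by (simp add: abs_mult power_abs)
    also have "\<dots> \<le> 1 * R + 1 * R"
      using \<delta>_le_1[of j] \<delta>_pos[of j] by (intro add_mono mult_mono) (auto simp: R_def power_le_one)
    finally have "\<bar>l j\<bar> \<le> 2 * R" by simp
    then have "log 2 (2 * \<bar>l j\<bar>) \<le> log 2 (4 * R)" using l1 by (subst log_le_cancel_iff) auto
    also have "\<dots> \<le> log 2 (4 * 2 powr (\<sigma> * (real (Suc J) ^ 2 + 3 * real (Suc J))))"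
      using hi l1 \<open>\<bar>l j\<bar> \<le> 2 * R\<close> by (subst log_le_cancel_iff) (auto simp: R_def)
    also have "\<dots> = log 2 (2 powr W)"
    proof -
      have "(4::real) = 2 powr 2" by simp
      then show ?thesis unfolding W_def
        by (simp only: powr_add[symmetric]) (simp add: power2_eq_square algebra_simps)
    qed
    also have "\<dots> = W" by simp
    finally have lg: "log 2 (2 * \<bar>l j\<bar>) \<le> W" .
    have "norm (digit_char j (l j)) \<le> 4 * (real j + 3) ^ 2 * log 2 (2 * \<bar>l j\<bar>) / 2 ^ j"
      by (rule norm_digit_char_le[OF large])
    also have "\<dots> \<le> 4 * (real J + 3) ^ 2 * W / 2 ^ j"
      using j lg l1 by (intro divide_right_mono mult_mono power_mono) auto
    finally show ?thesis using False by (simp add: B_def)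
  qed
  have bad_le: "(\<Prod>j<J. if bad j then 2 ^ J else (1::real)) \<le> 2 ^ J"
  proof -
    have "(\<Prod>j<J. if bad j then 2 ^ J else (1::real)) = (2 ^ J) ^ card {j \<in> {..<J}. bad j}"
      by (subst prod.inter_filter[symmetric]) auto
    also have "\<dots> \<le> (2 ^ J) ^ 1"
      using card_small_forms_le_1[OF lo] unfolding bad_def l_def by (intro power_increasing) auto
    finally show ?thesis by simp
  qed
  have prod_eq: "(\<Prod>j<n. B / 2 ^ j) = B powr real n * 2 powr (- (real n * (real n - 1) / 2))" for n
  proof (induction n)
    case (Suc n)
    have "B powr real (Suc n) = B powr real n * B" using B1 by (simp add: powr_add)
    moreover have "2 powr (- (real (Suc n) * (real (Suc n) - 1) / 2)) = 2 powr (- (real n * (real n - 1) / 2)) / 2 ^ n"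
    proof -
      have "- (real (Suc n) * (real (Suc n) - 1) / 2) = - (real n * (real n - 1) / 2) - real n"
        by (simp add: field_simps)
      then show ?thesis by (simp only: powr_diff powr_realpow zero_less_numeral)
    qed
    ultimately show ?case using Suc by simp
  qed (use B1 in simp)
  have "cmod (fourier_transform salem_measure (\<xi>, \<eta>)) \<le> (\<Prod>j<J. norm (digit_char j (l j)))"
    unfolding l_def by (rule fourier_transform_salem_measure_le)
  also have "\<dots> \<le> (\<Prod>j<J. B / 2 ^ j * (if bad j then 2 ^ J else 1))"
    using factor by (intro prod_mono) auto
  also have "\<dots> = (\<Prod>j<J. B / 2 ^ j) * (\<Prod>j<J. if bad j then 2 ^ J else 1)"
    by (rule prod.distrib)
  also have "\<dots> \<le> (\<Prod>j<J. B / 2 ^ j) * 2 ^ J"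
    using bad_le B1 by (intro mult_left_mono prod_nonneg) auto
  also have "\<dots> = B powr real J * 2 powr (- (real J * (real J - 1) / 2)) * 2 powr real J"
    unfolding prod_eq by (simp add: powr_realpow)
  finally show ?thesis by (simp only: B_def W_def)
qed

text \<open>The exponent of 2 has leading term -\<kappa> J^2 with \<kappa> = (1 - \<sigma> t)/2,
  which is positive exactly because t < s. The polynomial raised to the power J is only 2^O(J log
  J).\<close>

lemma scale_decay_bounded:
  assumes t: "0 \<le> t" "t < s"
  obtains C where "C > 0"
    "\<And>J. (4 * (real J + 3) ^ 2 * (2 + \<sigma> * (real J ^ 2 + 5 * real J + 4))) powr real J
      * 2 powr (- (real J * (real J - 1) / 2)) * 2 powr real J
      * 2 powr (\<sigma> * (real (Suc J) ^ 2 + 3 * real (Suc J)) * (t / 2)) \<le> C"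
proof -
  define h where "h = (\<lambda>J::nat. (4 * (real J + 3) ^ 2 * (2 + \<sigma> * (real J ^ 2 + 5 * real J + 4))) powr real J
      * 2 powr (- (real J * (real J - 1) / 2)) * 2 powr real J
      * 2 powr (\<sigma> * (real (Suc J) ^ 2 + 3 * real (Suc J)) * (t / 2)))"
  define \<kappa> where "\<kappa> = (1 - \<sigma> * t) / 2"
  have \<kappa>: "\<kappa> > 0" using t s_pos by (simp add: \<kappa>_def \<sigma>_def)
  have \<sigma>: "\<sigma> > 0" using \<sigma>_ge by simp
  have "h = (\<lambda>J. (4 * (real J + 3) ^ 2 * (2 + \<sigma> * (real J ^ 2 + 5 * real J + 4))) powr real J
      * 2 powr (- \<kappa> * real J ^ 2 + (3 / 2 + 5 * (1 - 2 * \<kappa>) / 2) * real J + 2 * (1 - 2 * \<kappa>)))"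
  proof
    fix J
    have st: "\<sigma> * t = 1 - 2 * \<kappa>" by (simp add: \<kappa>_def field_simps)
    have "\<sigma> * (real (Suc J) ^ 2 + 3 * real (Suc J)) * (t / 2) = (\<sigma> * t) * (real J ^ 2 + 5 * real J + 4) / 2"
      by (simp add: power2_eq_square algebra_simps)
    then have e: "- (real J * (real J - 1) / 2) + real J + \<sigma> * (real (Suc J) ^ 2 + 3 * real (Suc J)) * (t / 2)
       = - \<kappa> * real J ^ 2 + (3 / 2 + 5 * (1 - 2 * \<kappa>) / 2) * real J + 2 * (1 - 2 * \<kappa>)"
      unfolding st by (simp add: power2_eq_square field_simps)
    show "h J = (4 * (real J + 3) ^ 2 * (2 + \<sigma> * (real J ^ 2 + 5 * real J + 4))) powr real J
      * 2 powr (- \<kappa> * real J ^ 2 + (3 / 2 + 5 * (1 - 2 * \<kappa>) / 2) * real J + 2 * (1 - 2 * \<kappa>))"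
      unfolding h_def e[symmetric] powr_add by (simp only: mult.assoc)
  qed
  moreover have "(\<lambda>J. (4 * (real J + 3) ^ 2 * (2 + \<sigma> * (real J ^ 2 + 5 * real J + 4))) powr real J
      * 2 powr (- \<kappa> * real J ^ 2 + (3 / 2 + 5 * (1 - 2 * \<kappa>) / 2) * real J + 2 * (1 - 2 * \<kappa>))) \<longlonglongrightarrow> 0"
    using \<kappa> \<sigma> by real_asymp
  ultimately have "h \<longlonglongrightarrow> 0" by simp
  then have "Bseq h" by (intro convergent_imp_Bseq convergentI)
  then obtain C where "C > 0" "\<And>J. norm (h J) \<le> C" unfolding Bseq_def by blast
  then show ?thesis by (intro that[of C]) (auto simp: h_def abs_le_iff)
qed

text \<open>Frequencies are sorted by their maximum norm R between consecutive values of 2^(\<sigma>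
  (J^2 + 3J)). There \<open>R powr (t / 2)\<close> is at most the power of the upper end, the last
  factor in \<open>scale_decay_bounded\<close>. For R < 1 the trivial bound 1 is enough.\<close>

lemma fourier_decay_salem_measure:
  assumes t: "0 \<le> t" "t < s"
  shows "\<exists>C>0. \<forall>\<xi>. \<xi> \<noteq> 0 \<longrightarrow> cmod (fourier_transform salem_measure \<xi>) \<le> C * norm \<xi> powr (- t / 2)"
proof -
  obtain C where C: "C > 0" and scale: "\<And>J. (4 * (real J + 3) ^ 2 * (2 + \<sigma> * (real J ^ 2 + 5 * real J + 4))) powr real J
      * 2 powr (- (real J * (real J - 1) / 2)) * 2 powr real J
      * 2 powr (\<sigma> * (real (Suc J) ^ 2 + 3 * real (Suc J)) * (t / 2)) \<le> C"
    using scale_decay_bounded[OF t] by blast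
  define C' where "C' = 2 * max C 1"
  have t1: "t \<le> 1" using t s_le by simp
  have two: "2 powr (t / 2) \<le> (2::real)"
    using powr_mono[of "t / 2" 1 "2::real"] t1 by simp
  have "cmod (fourier_transform salem_measure (\<xi>, \<eta>)) \<le> C' * norm (\<xi>, \<eta>) powr (- t / 2)"
    if nz: "(\<xi>, \<eta>) \<noteq> 0" for \<xi> \<eta>
  proof -
    define R where "R = max \<bar>\<xi>\<bar> \<bar>\<eta>\<bar>"
    have norm_pos: "norm (\<xi>, \<eta>) > 0" using nz by (subst zero_less_norm_iff)
    have norm_le: "norm (\<xi>, \<eta>) \<le> 2 * R"
      using norm_Pair_le[of \<xi> \<eta>] by (auto simp: R_def)
    have R_pos: "R > 0" using norm_pos norm_le by linarith
    have R_powr: "R powr (- t / 2) \<le> 2 * norm (\<xi>, \<eta>) powr (- t / 2)"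
    proof -
      have "R powr (- t / 2) \<le> (norm (\<xi>, \<eta>) / 2) powr (- t / 2)"
        using norm_le norm_pos t by (intro powr_mono2') auto
      also have "\<dots> = 2 powr (t / 2) * norm (\<xi>, \<eta>) powr (- t / 2)"
        using norm_pos by (simp add: powr_divide powr_minus field_simps)
      also have "\<dots> \<le> 2 * norm (\<xi>, \<eta>) powr (- t / 2)" using two by (intro mult_right_mono) auto
      finally show ?thesis .
    qed
    have "cmod (fourier_transform salem_measure (\<xi>, \<eta>)) \<le> max C 1 * R powr (- t / 2)"
    proof (cases "R < 1")
      case True
      have "cmod (fourier_transform salem_measure (\<xi>, \<eta>)) \<le> 1"
        using fourier_transform_salem_measure_le[of \<xi> \<eta> 0] by simp
      also have "1 \<le> R powr (- t / 2)"
        using powr_mono2'[of "- t / 2" R 1] True R_pos t by simp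
      also have "\<dots> \<le> max C 1 * R powr (- t / 2)"
        using mult_right_mono[of 1 "max C 1" "R powr (- t / 2)"] by simp
      finally show ?thesis .
    next
      case False
      define g where "g n = 2 powr (\<sigma> * (real n ^ 2 + 3 * real n))" for n
      have "\<exists>n. R < g n"
      proof -
        obtain n where "R < 2 ^ n" using real_arch_pow[of 2 R] by auto
        also have "(2::real) ^ n = 2 powr (1 * real n)" by (simp add: powr_realpow)
        also have "\<dots> \<le> g n" unfolding g_def
          using \<sigma>_ge by (intro powr_mono mult_mono) (auto simp: power2_eq_square)
        finally show ?thesis by blast
      qed
      \<comment> \<open>Since g 0 = 1 <= R, the least N with R < g N is a successor, and its
        predecessor bounds R from below.\<close>
      define N where "N = (LEAST n. R < g n)"
      have N: "R < g N" unfolding N_def using \<open>\<exists>n. R < g n\<close> by (rule LeastI_ex)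
      moreover have "\<not> R < g 0" using False by (simp add: g_def)
      ultimately obtain J where J: "N = Suc J" by (cases N) auto
      have "g J \<le> R" using not_less_Least[of J "\<lambda>n. R < g n"] J unfolding N_def by simp
      then have lo: "2 powr (\<sigma> * (real J ^ 2 + 3 * real J)) \<le> max \<bar>\<xi>\<bar> \<bar>\<eta>\<bar>"
        by (simp add: g_def R_def)
      have hi: "max \<bar>\<xi>\<bar> \<bar>\<eta>\<bar> < 2 powr (\<sigma> * (real (Suc J) ^ 2 + 3 * real (Suc J)))"
        using N unfolding J g_def R_def .
      define H where "H = (4 * (real J + 3) ^ 2 * (2 + \<sigma> * (real J ^ 2 + 5 * real J + 4))) powr real J
        * 2 powr (- (real J * (real J - 1) / 2)) * 2 powr real J"
      have H0: "H \<ge> 0" by (simp add: H_def)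
      have "R powr (t / 2) \<le> g (Suc J) powr (t / 2)"
        using N R_pos t unfolding J by (intro powr_mono2) auto
      also have "\<dots> = 2 powr (\<sigma> * (real (Suc J) ^ 2 + 3 * real (Suc J)) * (t / 2))"
        unfolding g_def by (rule powr_powr)
      finally have "H * R powr (t / 2) \<le> H * 2 powr (\<sigma> * (real (Suc J) ^ 2 + 3 * real (Suc J)) * (t / 2))"
        using H0 by (rule mult_left_mono)
      also have "\<dots> \<le> C" unfolding H_def by (rule scale)
      finally have "H \<le> C * R powr (- t / 2)" using R_pos by (simp add: powr_minus field_simps)
      also have "\<dots> \<le> max C 1 * R powr (- t / 2)" by (intro mult_right_mono) auto
      finally show ?thesis
        using fourier_transform_salem_measure_le_scale[OF lo hi] by (simp add: H_def)
    qed
    also have "\<dots> \<le> max C 1 * (2 * norm (\<xi>, \<eta>) powr (- t / 2))"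
      using R_powr by (intro mult_left_mono) auto
    finally show ?thesis by (simp add: C'_def)
  qed
  moreover have "C' > 0" by (simp add: C'_def)
  ultimately show ?thesis by (intro exI[of _ C']) auto
qed

section \<open>Upper bound for the decay exponent\<close>

text \<open>If t exceeded s, the projection of the measure to the first axis would live on the few
  intervals of \<open>nbhd J\<close> for every J. Applying \<open>covering_card_ge\<close> with
  exponent s then bounds 1 by a constant times 2^(-2J) (1 + E J), which tends to 0.\<close>

lemma decay_exponent_le:
  assumes \<mu>: "\<mu> \<in> prob_measures_on (graph_on {0..1} f)"
    and decay: "\<forall>\<xi>. \<xi> \<noteq> 0 \<longrightarrow> cmod (fourier_transform \<mu> \<xi>) \<le> C * norm \<xi> powr (- t / 2)"
  shows "t \<le> s"
proof (rule ccontr)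
  assume "\<not> t \<le> s"
  then have ts: "s < t" by simp
  have bp: "borel_prob_measure \<mu>" using \<mu> by (simp add: prob_measures_on_def)
  interpret prob_space \<mu> using bp by (simp add: borel_prob_measure_def)
  have sets[measurable_cong]: "sets \<mu> = sets borel" using bp by (simp add: borel_prob_measure_def)
  have on_graph: "AE z in \<mu>. z \<in> graph_on {0..1} f"
    using \<mu> by (intro AE_in_of_spt_subset) (auto simp: prob_measures_on_def)
  have cover: "AE z in \<mu>. \<exists>c\<in>ends J. \<bar>fst z - c\<bar> \<le> 3 / 2 * \<delta> J" for J
  proof -
    \<comment> \<open>Off \<open>nbhd J\<close> the graph of f is covered by these lines, and the
      measure charges none of them.\<close>
    obtain L where L: "countable L" "\<And>x. \<exists>(m, c)\<in>L. (\<Sum>j<J. (1 / 2) ^ j * digit_fun j x) = m * x + c"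
      using graph_in_lines_partial[of J] unfolding graph_in_lines_def by blast
    have "AE z in \<mu>. \<forall>(m, c)\<in>L. snd z \<noteq> m * fst z + c"
      using L(1) AE_not_on_line[OF bp decay] ts s_pos by (subst AE_ball_countable) auto
    with on_graph show ?thesis
    proof eventually_elim
      case (elim z)
      then obtain x where z: "z = (x, f x)" by (auto simp: graph_on_def)
      have "x \<in> nbhd J"
      proof (rule ccontr)
        assume "x \<notin> nbhd J"
        then have "f x = (\<Sum>j<J. (1 / 2) ^ j * digit_fun j x)" by (rule f_outside)
        then show False using elim(2) L(2)[of x] z by auto
      qed
      then show ?case by (simp add: nbhd_def z)
    qed
  qed
  define D where "D = (C * norm (1 :: real, 0 :: real) powr (- t / 2))\<^sup>2"
  define E where "E J = \<sigma> * (real J ^ 2 + 3 * real J)" for J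
  have \<delta>_E: "\<delta> J = 2 powr (- E J)" for J by (simp add: \<delta>_def E_def)
  have bound: "1 \<le> 2 ^ (J ^ 2 + J) * ((2 + 4 * D) * (48 * 2 powr (- (real J ^ 2 + 3 * real J))) * (1 + E J))"
    if J: "J \<ge> 2" for J
  proof -
    \<comment> \<open>The largest N permitted by the diameter \<open>3 * \<delta> J\<close> of the
      intervals. As \<open>1 / \<delta> J\<close> is at least 1024, rounding down loses at most a
      factor 2, whence 48.\<close>
    define N where "N = nat \<lfloor>1 / (24 * \<delta> J)\<rfloor>"
    have E_ge: "10 \<le> E J"
    proof -
      have "2 ^ 2 \<le> real J ^ 2" using J by (intro power_mono) auto
      then have "1 * 10 \<le> \<sigma> * (real J ^ 2 + 3 * real J)" using J \<sigma>_ge by (intro mult_mono) auto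
      then show ?thesis by (simp add: E_def)
    qed
    have "2 powr 10 \<le> 2 powr E J" using E_ge by (intro powr_mono) auto
    then have inv: "1024 \<le> 1 / \<delta> J" by (simp add: \<delta>_E powr_minus_divide)
    then have N_le: "real N \<le> 1 / (24 * \<delta> J)" and N_ge: "1 / (48 * \<delta> J) \<le> real N" and N_pos: "N > 0"
      unfolding N_def by (simp_all add: field_simps) linarith+
    have "1 \<le> real (card (ends J)) * ((2 + 4 * D) * real N powr (- s) * (1 + ln (real N)))"
    proof (rule covering_card_ge[where h = fst and r = "3 / 2 * \<delta> J"])
      show "fst \<in> borel_measurable \<mu>"
        unfolding measurable_cong_sets[OF sets refl]
        by (intro borel_measurable_continuous_onI continuous_intros)
      show "2 * (3 / 2 * \<delta> J) < \<bar>c - c'\<bar>" if "c \<in> ends J" "c' \<in> ends J" "c \<noteq> c'" for c c'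
        using ends_sep[OF that] \<delta>_pos[of J] by linarith
      show "2 * (3 / 2 * \<delta> J) \<le> 1 / (8 * real N)"
        using N_le N_pos \<delta>_pos[of J] by (simp add: field_simps)
      fix k :: int assume k: "k \<noteq> 0"
      have "(cmod (LINT z|\<mu>. cis (2 * pi * real_of_int k * (z \<bullet> (1, 0)))))\<^sup>2 \<le> D * \<bar>real_of_int k\<bar> powr - s"
        unfolding D_def using k ts by (intro decay_along_direction decay) (auto simp: zero_prod_def)
      then show "(cmod (LINT z|\<mu>. cis (2 * pi * real_of_int k * fst z)))\<^sup>2 \<le> D * \<bar>real_of_int k\<bar> powr - s"
        by (simp add: inner_prod_def)
    qed (use finite_ends cover N_pos s_pos s_le \<delta>_pos[of J] in \<open>auto simp: D_def less_imp_le\<close>)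
    also have "\<dots> \<le> 2 ^ (J ^ 2 + J) * ((2 + 4 * D) * (48 * 2 powr (- (real J ^ 2 + 3 * real J))) * (1 + E J))"
    proof (intro mult_mono)
      show "real (card (ends J)) \<le> 2 ^ (J ^ 2 + J)"
        using card_ends[of J] by (metis of_nat_le_iff of_nat_numeral of_nat_power)
      have "real N powr (- s) \<le> (1 / (48 * \<delta> J)) powr (- s)"
        using N_ge \<delta>_pos[of J] s_pos by (intro powr_mono2') auto
      also have "\<dots> = 48 powr s * \<delta> J powr s"
        using \<delta>_pos[of J] by (simp add: powr_divide powr_mult powr_minus field_simps)
      also have "\<dots> \<le> 48 * \<delta> J powr s"
        using powr_mono[of s 1 "48::real"] s_le by (intro mult_right_mono) auto
      also have "\<delta> J powr s = 2 powr (- (real J ^ 2 + 3 * real J))"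
        using s_pos by (simp add: \<delta>_def powr_powr \<sigma>_def)
      finally show "real N powr (- s) \<le> 48 * 2 powr (- (real J ^ 2 + 3 * real J))" .
      have "ln (real N) \<le> ln (1 / \<delta> J)"
      proof (rule ln_mono)
        show "real N \<le> 1 / \<delta> J" using N_le \<delta>_pos[of J] by (simp add: field_simps)
      qed (use N_pos in simp)
      also have "\<dots> = E J * ln 2" by (simp add: \<delta>_E ln_div ln_powr)
      also have "\<dots> \<le> E J * 1" using E_ge ln_2_less_1 by (intro mult_left_mono) auto
      finally show "1 + ln (real N) \<le> 1 + E J" by simp
    qed (use N_pos E_ge in \<open>auto simp: D_def\<close>)
    finally show ?thesis .
  qed
  have pow: "2 ^ (J ^ 2 + J) * 2 powr (- (real J ^ 2 + 3 * real J)) = 2 powr (- 2 * real J)" for J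
  proof -
    have "(2::real) ^ (J ^ 2 + J) = 2 powr (real J ^ 2 + real J)" by (subst powr_realpow[symmetric]) auto
    then show ?thesis by (simp add: powr_add[symmetric])
  qed
  have eq: "2 ^ (J ^ 2 + J) * ((2 + 4 * D) * (48 * 2 powr (- (real J ^ 2 + 3 * real J))) * (1 + E J))
    = (2 + 4 * D) * 48 * 2 powr (- 2 * real J) * (1 + E J)" for J
    unfolding pow[symmetric] by (simp only: ac_simps)
  have "\<forall>J\<ge>2. 1 \<le> (2 + 4 * D) * 48 * 2 powr (- 2 * real J) * (1 + E J)"
    using bound unfolding eq by blast
  moreover have "(\<lambda>J. (2 + 4 * D) * 48 * 2 powr (- 2 * real J) * (1 + E J)) \<longlonglongrightarrow> 0"
    unfolding E_def using \<sigma>_ge by real_asymp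
  ultimately have "1 \<le> (0::real)" by (intro LIMSEQ_le_const) blast+
  then show False by simp
qed

end

section \<open>The dimension from the two bounds\<close>

text \<open>The supremum need not be attained, so \<open>lower\<close> asks only for exponents below
  s. A point mass puts 0 into the set, which keeps it nonempty also when s = 0 and
  \<open>lower\<close> is vacuous.\<close>

lemma fourier_dim_eqI:
  assumes "0 \<le> s" "s \<le> 2" "K \<noteq> {}"
    and lower: "\<And>t. 0 \<le> t \<Longrightarrow> t < s \<Longrightarrow> \<exists>\<mu>\<in>prob_measures_on K. \<exists>C>0. \<forall>\<xi>. \<xi> \<noteq> 0 \<longrightarrow>
      cmod (fourier_transform \<mu> \<xi>) \<le> C * norm \<xi> powr (- t / 2)"
    and upper: "\<And>t \<mu> C. 0 < t \<Longrightarrow> \<mu> \<in> prob_measures_on K \<Longrightarrow>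
      \<forall>\<xi>. \<xi> \<noteq> 0 \<longrightarrow> cmod (fourier_transform \<mu> \<xi>) \<le> C * norm \<xi> powr (- t / 2) \<Longrightarrow> t \<le> s"
  shows "fourier_dim K = s"
proof -
  define A where "A = {s. 0 \<le> s \<and> s \<le> 2 \<and>
     (\<exists>\<mu>\<in>prob_measures_on K. \<exists>C>0. \<forall>\<xi>. \<xi> \<noteq> 0 \<longrightarrow>
        cmod (fourier_transform \<mu> \<xi>) \<le> C * norm \<xi> powr (- s / 2))}"
  obtain x where x: "x \<in> K" using assms by blast
  have A0: "0 \<in> A"
  proof -
    have spt: "spt (return borel x) \<subseteq> {x}"
      by (rule spt_subset_closed) (auto simp: AE_return)
    have mem: "return borel x \<in> prob_measures_on K"
      using spt x by (auto simp: prob_measures_on_def borel_prob_measure_def prob_space_return)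
    interpret prob_space "return borel x" by (rule prob_space_return) simp
    have "cmod (fourier_transform (return borel x) \<xi>) \<le> (LINT z|return borel x. norm (cis (- (2 * pi * (z \<bullet> \<xi>)))))" for \<xi>
      unfolding fourier_transform_cis by (rule integral_norm_bound)
    then have "cmod (fourier_transform (return borel x) \<xi>) \<le> 1" for \<xi> using prob_space by simp
    then show ?thesis unfolding A_def using mem by (auto intro!: bexI[OF _ mem] exI[of _ 1])
  qed
  have ub: "t \<le> s" if "t \<in> A" for t
    using that upper[of t] assms(1) unfolding A_def by (cases "t > 0") auto
  have "Sup A = s"
  proof (rule cSup_eq_non_empty)
    show "A \<noteq> {}" using A0 by blast
    show "s \<le> y" if "\<And>t. t \<in> A \<Longrightarrow> t \<le> y" for y
    proof (rule dense_le)
      fix t assume "t < s"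
      show "t \<le> y"
      proof (cases "0 \<le> t")
        case True
        then have "t \<in> A" unfolding A_def using lower[of t] \<open>t < s\<close> assms(2) by auto
        then show ?thesis by (rule that)
      next
        case False
        then show ?thesis using that[OF A0] by simp
      qed
    qed
  qed (use ub in auto)
  then show ?thesis by (simp add: fourier_dim_def A_def)
qed

theorem proposition1p1:
  fixes s :: real
  assumes "s \<in> {0..1}"
  shows "\<exists>f :: real \<Rightarrow> real. continuous_on {0..1} f \<and> fourier_dim (graph_on {0..1} f) = s"
proof (cases "s = 0")
  case True
  \<comment> \<open>For s = 0 the zero function works: its graph lies on one line, which a measure
    with decay cannot charge.\<close>
  have "fourier_dim (graph_on {0..1} (\<lambda>_. 0)) = 0"
  proof (rule fourier_dim_eqI)
    show "graph_on {0..1} (\<lambda>_. 0) \<noteq> {}" by (auto simp: graph_on_def)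
    fix t :: real and \<mu> C
    assume t: "0 < t" and \<mu>: "\<mu> \<in> prob_measures_on (graph_on {0..1} (\<lambda>_. 0))"
      and decay: "\<forall>\<xi>. \<xi> \<noteq> 0 \<longrightarrow> cmod (fourier_transform \<mu> \<xi>) \<le> C * norm \<xi> powr (- t / 2)"
    have bp: "borel_prob_measure \<mu>" using \<mu> by (simp add: prob_measures_on_def)
    interpret prob_space \<mu> using bp by (simp add: borel_prob_measure_def)
    have "AE z in \<mu>. z \<in> graph_on {0..1} (\<lambda>_. 0)"
      using \<mu> by (intro AE_in_of_spt_subset) (auto simp: prob_measures_on_def)
    moreover have "AE z in \<mu>. snd z \<noteq> 0 * fst z + 0" by (rule AE_not_on_line[OF bp decay t])
    ultimately have "AE z in \<mu>. False" by eventually_elim (auto simp: graph_on_def)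
    then show "t \<le> 0" using AE_False prob_space by simp
  qed auto
  then show ?thesis using True by (intro exI[of _ "\<lambda>_. 0"]) auto
next
  case False
  then interpret salem_graph s using assms by unfold_locales auto
  have "fourier_dim (graph_on {0..1} f) = s"
  proof (rule fourier_dim_eqI)
    show "graph_on {0..1} f \<noteq> {}" by (auto simp: graph_on_def)
    show "\<exists>\<mu>\<in>prob_measures_on (graph_on {0..1} f). \<exists>C>0. \<forall>\<xi>. \<xi> \<noteq> 0 \<longrightarrow>
        cmod (fourier_transform \<mu> \<xi>) \<le> C * norm \<xi> powr (- t / 2)" if "0 \<le> t" "t < s" for t
      using fourier_decay_salem_measure[OF that] salem_measure_on_graph by blast
  qed (use decay_exponent_le s_pos s_le in auto)
  then show ?thesis using continuous_f by blast
qed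

end
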